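(* Let $(D)$ be a degree of regularity from Hölder to $C^{\infty}$, and let $\mathcal{D}$ be the collection of orientation-preserving homeomorphisms of the circle $\mathbb{S}^1$ with regularity $(D)$. Then there is no complete numerical Borel invariant for $\mathcal{D}$-conjugacy of orientation-preserving $C^{\infty}$ diffeomorphisms of the circle. That is, there is no Borel function $\varphi:\mathcal{H}^{\infty}\to\mathbb{R}$ such that for all $S,T\in\mathcal{H}^{\infty}$: $S$ and $T$ are $\mathcal{D}$-conjugate if and only if $\varphi(S)=\varphi(T)$.
   Context: $\mathbb{S}^1=\mathbb{R}/\mathbb{Z}$. $\mathcal{H}$ is the set of orientation-preserving homeomorphisms of $\mathbb{S}^1$. For an integer $k\ge 1$ or $k=\infty$, $\mathcal{H}^k$ is the set of orientation-preserving $C^k$-diffeomorphisms of $\mathbb{S}^1$. For $0<\beta<1$ and an integer $k\ge 0$, $\mathcal{H}^{k+\beta}$ is the set of elements of $\mathcal{H}^k$ (with $\mathcal{H}^0=\mathcal{H}$) whose $k$-th derivative is $\beta$-Hölder continuous (for $k=0$: the homeomorphisms that are themselves $\beta$-Hölder). "A degree of regularity from Hölder to $C^\infty$" means that $\mathcal{D}$ is one of: $\bigcup_{0<\beta<1}\mathcal{H}^{0+\beta}$ (Hölder homeomorphisms), $\mathcal{H}^{k+\beta}$ with $k\ge 0$ an integer and $0<\beta<1$, $\mathcal{H}^k$ with $k\ge1$ an integer, or $\mathcal{H}^{\infty}$. $S,T\in\mathcal{H}^\infty$ are $\mathcal{D}$-conjugate if there is $h\in\mathcal{D}$ with $S=h\circ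 T\circ h^{-1}$. $\mathcal{H}^{\infty}$ is a Polish space with the metric $d_{\infty}(f,g)=\sum_{k\ge1}\frac{d_k(f,g)}{2^k(1+d_k(f,g))}$, where $d_k(f,g)=\max\{\|f-g\|_k,\|f^{-1}-g^{-1}\|_k\}$ and $\|f\|_k=\max_{0\le i\le k}\max_{x}|D^if(x)|$ (the order-zero term of a difference being measured by distance on the circle). Borel refers to this topology. *)

theory Defs
  imports "HOL-Analysis.Analysis"
begin

quotient_type circle = real / "\<lambda>x y. x - y \<in> \<int>"
  morphisms rep_circle to_circle
proof (rule equivpI)
  show "reflp (\<lambda>x y::real. x - y \<in> \<int>)"
    by (simp add: reflp_def)
  show "symp (\<lambda>x y::real. x - y \<in> \<int>)"
    by (auto intro!: sympI) (metis Ints_minus minus_diff_eq)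
  show "transp (\<lambda>x y::real. x - y \<in> \<int>)"
  proof (rule transpI)
    fix x y z :: real assume "x - y \<in> \<int>" "y - z \<in> \<int>"
    then have "(x - y) + (y - z) \<in> \<int>" by (rule Ints_add)
    then show "x - z \<in> \<int>" by simp
  qed
qed

lemma to_circle_eq_iff: "to_circle x = to_circle y \<longleftrightarrow> x - y \<in> \<int>"
  by (simp add: circle.abs_eq_iff)

lemma to_circle_rep [simp]: "to_circle (rep_circle p) = p"
  using Quotient3_abs_rep[OF Quotient3_circle] .

lemma dist_round_shift:
  fixes x y :: real
  assumes "x - y \<in> \<int>"
  shows "\<bar>x - of_int (round x)\<bar> = \<bar>y - of_int (round y)\<bar>"
proof -
  from assms obtain n where n: "x = y + of_int n"
    by (metis Ints_cases add.commute diff_add_cancel)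
  have "round x = round y + n"
  proof -
    have "x + 1/2 = y + 1/2 + of_int n" by (simp add: n)
    then show ?thesis unfolding round_def by (simp only: floor_add_int)
  qed
  then show ?thesis by (simp add: n)
qed

instantiation circle :: metric_space
begin

text \<open>Distance of points = distance of the difference of representatives to the nearest integer.\<close>

lift_definition dist_circle :: "circle \<Rightarrow> circle \<Rightarrow> real"
  is "\<lambda>x y. \<bar>(x - y) - of_int (round (x - y))\<bar>"
proof (rule dist_round_shift)
  fix a b c d :: real
  assume "a - b \<in> \<int>" "c - d \<in> \<int>"
  then have "(a - b) - (c - d) \<in> \<int>" by (rule Ints_diff)
  then show "(a - c) - (b - d) \<in> \<int>" by (simp add: algebra_simps)
qed

definition uniformity_circle :: "(circle \<times> circle) filter" where
  "uniformity_circle = (INF e\<in>{0<..}. principal {(x, y). dist x y < e})"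

definition open_circle :: "circle set \<Rightarrow> bool" where
  "open_circle U \<longleftrightarrow> (\<forall>x\<in>U. eventually (\<lambda>(x', y). x' = x \<longrightarrow> y \<in> U) uniformity)"

instance
proof
  fix p q r :: circle and U :: "circle set"
  show "(uniformity :: (circle \<times> circle) filter) = (INF e\<in>{0<..}. principal {(x, y). dist x y < e})"
    by (rule uniformity_circle_def)
  show "open U \<longleftrightarrow> (\<forall>x\<in>U. \<forall>\<^sub>F (x', y) in uniformity. x' = x \<longrightarrow> y \<in> U)"
    by (rule open_circle_def)
  show "dist p q = 0 \<longleftrightarrow> p = q"
  proof transfer
    fix x y :: real
    show "\<bar>(x - y) - of_int (round (x - y))\<bar> = 0 \<longleftrightarrow> x - y \<in> \<int>"
    proof
      assume "\<bar>(x - y) - of_int (round (x - y))\<bar> = 0"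
      then have "x - y = of_int (round (x - y))" by simp
      then show "x - y \<in> \<int>" by (metis Ints_of_int)
    next
      assume "x - y \<in> \<int>"
      then obtain n where "x - y = of_int n" by (auto elim: Ints_cases)
      then show "\<bar>(x - y) - of_int (round (x - y))\<bar> = 0" by simp
    qed
  qed
  show "dist p q \<le> dist p r + dist q r"
  proof transfer
    fix x y z :: real
    have "\<bar>(x - y) - of_int (round (x - y))\<bar>
        \<le> \<bar>(x - y) - of_int (round (x - z) - round (y - z))\<bar>"
      by (rule round_diff_minimal)
    also have "\<dots> \<le> \<bar>(x - z) - of_int (round (x - z))\<bar> + \<bar>(y - z) - of_int (round (y - z))\<bar>"
      by simp
    finally show "\<bar>(x - y) - of_int (round (x - y))\<bar>
        \<le> \<bar>(x - z) - of_int (round (x - z))\<bar> + \<bar>(y - z) - of_int (round (y - z))\<bar>" .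
  qed
qed

end

lemma dist_to_circle:
  "dist (to_circle x) (to_circle y) = \<bar>(x - y) - of_int (round (x - y))\<bar>"
  by (rule dist_circle.abs_eq)

lemma dist_circle_le_half: "dist (p::circle) q \<le> 1/2"
  by transfer (metis of_int_round_abs_le abs_minus_commute)

lemma dist_to_circle_le: "dist (to_circle x) (to_circle y) \<le> dist x y"
  using round_diff_minimal[of "x - y" 0] by (simp add: dist_to_circle dist_real_def)

lemma continuous_to_circle: "continuous_on A to_circle"
  unfolding continuous_on_iff by (meson dist_to_circle_le le_less_trans)

lemma open_circle_iff: "open U \<longleftrightarrow> open (to_circle -` U)"
proof
  assume "open U"
  then show "open (to_circle -` U)"
    using continuous_to_circle[of UNIV] by (simp add: continuous_on_open_vimage)
next
  assume U: "open (to_circle -` U)"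
  show "open U"
    unfolding open_dist
  proof
    fix p assume p: "p \<in> U"
    define x where "x = rep_circle p"
    have "x \<in> to_circle -` U" using p by (simp add: x_def)
    then obtain e where e: "e > 0" "\<And>y. dist y x < e \<Longrightarrow> to_circle y \<in> U"
      using U unfolding open_dist by auto
    have "q \<in> U" if "dist q p < e" for q
    proof -
      define y where "y = rep_circle q - of_int (round (rep_circle q - x))"
      have "dist y x < e"
        using that dist_to_circle[of "rep_circle q" x]
        by (simp add: y_def x_def dist_real_def algebra_simps)
      moreover have "to_circle y = to_circle (rep_circle q)"
        unfolding to_circle_eq_iff y_def by simp
      ultimately show ?thesis using e(2) by force
    qed
    then show "\<exists>e>0. \<forall>q. dist q p < e \<longrightarrow> q \<in> U" using e(1) by blast
  qed
qed

definition is_lift :: "(real \<Rightarrow> real) \<Rightarrow> (circle \<Rightarrow> circle) \<Rightarrow> bool" where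
  "is_lift F f \<longleftrightarrow> continuous_on UNIV F \<and> (\<forall>x. to_circle (F x) = f (to_circle x))"

text \<open>Preservation of orientation is expressed by a strictly increasing lift.\<close>

definition circle_homeos :: "(circle \<Rightarrow> circle) set" where
  "circle_homeos = {f. (\<exists>g. homeomorphism UNIV UNIV f g) \<and> (\<exists>F. is_lift F f \<and> strict_mono F)}"

definition C_k_real :: "nat \<Rightarrow> (real \<Rightarrow> real) \<Rightarrow> bool" where
  "C_k_real k F \<longleftrightarrow>
     (\<forall>i<k. \<forall>x. (deriv ^^ i) F differentiable (at x)) \<and> continuous_on UNIV ((deriv ^^ k) F)"

definition C_k_circle :: "nat \<Rightarrow> (circle \<Rightarrow> circle) \<Rightarrow> bool" where
  "C_k_circle k f \<longleftrightarrow> (\<exists>F. is_lift F f \<and> C_k_real k F)"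

definition circle_diffeos :: "nat \<Rightarrow> (circle \<Rightarrow> circle) set" where
  "circle_diffeos k = {f \<in> circle_homeos. C_k_circle k f \<and> C_k_circle k (inv f)}"

definition smooth_diffeos :: "(circle \<Rightarrow> circle) set" where
  "smooth_diffeos = (\<Inter>k. circle_diffeos k)"

lemma lifts_differ_by_int:
  assumes "is_lift F f" "is_lift G f"
  obtains n :: int where "\<And>x. G x = F x + of_int n"
proof -
  have int: "G x - F x \<in> \<int>" for x
    using assms by (simp add: is_lift_def flip: to_circle_eq_iff)
  have "(\<lambda>x. G x - F x) constant_on UNIV"
  proof (rule continuous_discrete_range_constant)
    show "continuous_on UNIV (\<lambda>x. G x - F x)"
      using assms by (auto simp: is_lift_def intro: continuous_on_diff)
    fix x :: real
    have "1 \<le> norm ((G y - F y) - (G x - F x))" if "G y - F y \<noteq> G x - F x" for y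
      using that Ints_diff[OF int[of y] int[of x]] Ints_nonzero_abs_ge1
      by (metis eq_iff_diff_eq_0 real_norm_def)
    then show "\<exists>e>0. \<forall>y. y \<in> UNIV \<and> G y - F y \<noteq> G x - F x \<longrightarrow>
        e \<le> norm ((G y - F y) - (G x - F x))"
      by (intro exI[of _ 1]) auto
  qed simp
  then obtain c where c: "\<And>x. G x - F x = c" by (auto simp: constant_on_def)
  with int[of 0] obtain n where "c = of_int n" by (metis Ints_cases)
  then show ?thesis using that[of n] c by (metis add.commute diff_add_cancel)
qed

lemma lift_shift:
  assumes "is_lift F f" and "m \<in> \<int>"
  shows "is_lift (\<lambda>x. F (x + m)) f"
proof -
  have "to_circle (x + m) = to_circle x" for x
    using assms(2) by (simp add: to_circle_eq_iff)
  moreover have "continuous_on UNIV (\<lambda>x. F (x + m))"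
  proof (rule continuous_on_compose2[of UNIV F UNIV "\<lambda>x. x + m"])
    show "continuous_on UNIV F" using assms(1) by (simp add: is_lift_def)
    show "continuous_on UNIV (\<lambda>x. x + m)" by (intro continuous_intros)
  qed simp
  ultimately show ?thesis using assms(1) by (simp add: is_lift_def)
qed

lemma higher_deriv_add_const:
  assumes "i \<ge> 1"
  shows "(deriv ^^ i) (\<lambda>x. F x + (c::real)) = (deriv ^^ i) F"
proof -
  have "deriv (\<lambda>x. F x + c) = deriv F"
  proof
    fix x
    have "((\<lambda>x. F x + c) has_field_derivative D) (at x) \<longleftrightarrow> (F has_field_derivative D) (at x)" for D
    proof
      assume "((\<lambda>x. F x + c) has_field_derivative D) (at x)"
      from DERIV_diff[OF this DERIV_const[of c]]
      show "(F has_field_derivative D) (at x)" by simp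
    next
      assume "(F has_field_derivative D) (at x)"
      from DERIV_add[OF this DERIV_const[of c]]
      show "((\<lambda>x. F x + c) has_field_derivative D) (at x)" by simp
    qed
    then show "deriv (\<lambda>x. F x + c) x = deriv F x" by (simp add: deriv_def)
  qed
  moreover from assms obtain j where "i = Suc j" by (cases i) auto
  ultimately show ?thesis by (simp only: funpow_Suc_right o_apply)
qed

lemma higher_deriv_shift:
  "(deriv ^^ i) (\<lambda>x. F (x + (m::real))) = (\<lambda>x. (deriv ^^ i) F (x + m))"
proof (induction i)
  case (Suc i)
  then show ?case by (simp add: deriv_def DERIV_shift)
qed simp

text \<open>
  Two lifts of the same map differ by an integer constant, so for \<open>i \<ge> 1\<close> the following does not
  depend on the choice of the lift or of the representative (lemma \<open>circle_deriv_eq\<close> below). It is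
  only used for \<open>i \<ge> 1\<close>.
\<close>
definition circle_deriv :: "nat \<Rightarrow> (circle \<Rightarrow> circle) \<Rightarrow> circle \<Rightarrow> real" where
  "circle_deriv i f p = (deriv ^^ i) (SOME F. is_lift F f) (rep_circle p)"

lemma circle_deriv_eq:
  assumes "is_lift F f" "i \<ge> 1"
  shows "circle_deriv i f (to_circle x) = (deriv ^^ i) F x"
proof -
  define G where "G = (SOME F. is_lift F f)"
  define m where "m = rep_circle (to_circle x) - x"
  have "to_circle (rep_circle (to_circle x)) = to_circle x" by simp
  then have m: "m \<in> \<int>" unfolding m_def to_circle_eq_iff .
  have "is_lift G f" unfolding G_def using assms(1) by (rule someI[of "\<lambda>F. is_lift F f"])
  then obtain n where n: "\<And>y. G (y + m) = F y + of_int n"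
    using lifts_differ_by_int[OF assms(1) lift_shift[OF _ m]] by metis
  have "(deriv ^^ i) G (x + m) = (deriv ^^ i) (\<lambda>y. G (y + m)) x"
    by (simp add: higher_deriv_shift)
  also have "\<dots> = (deriv ^^ i) F x"
    using assms(2) by (simp add: n higher_deriv_add_const)
  finally show ?thesis by (simp add: circle_deriv_def G_def m_def)
qed

lemma bounded_circle_deriv:
  assumes "C_k_circle i f" "i \<ge> 1"
  shows "bounded (range (circle_deriv i f))"
proof -
  obtain F where F: "is_lift F f" "continuous_on UNIV ((deriv ^^ i) F)"
    using assms(1) by (auto simp: C_k_circle_def C_k_real_def)
  have "bounded ((deriv ^^ i) F ` {0..1})"
    using F(2) by (intro compact_imp_bounded compact_continuous_image) (auto intro: continuous_on_subset)
  moreover have "range (circle_deriv i f) \<subseteq> (deriv ^^ i) F ` {0..1}"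
  proof
    fix r assume "r \<in> range (circle_deriv i f)"
    then obtain p where r: "r = circle_deriv i f p" by blast
    have "to_circle (frac (rep_circle p)) = to_circle (rep_circle p)"
      unfolding to_circle_eq_iff frac_def by simp
    then have "r = circle_deriv i f (to_circle (frac (rep_circle p)))" by (simp add: r)
    also have "\<dots> = (deriv ^^ i) F (frac (rep_circle p))"
      using F(1) assms(2) by (rule circle_deriv_eq)
    finally show "r \<in> (deriv ^^ i) F ` {0..1}"
      by (auto simp: frac_ge_0 frac_lt_1 less_imp_le)
  qed
  ultimately show ?thesis by (rule bounded_subset)
qed

definition hoelder_on_circle :: "real \<Rightarrow> (circle \<Rightarrow> 'a::metric_space) \<Rightarrow> bool" where
  "hoelder_on_circle \<beta> u \<longleftrightarrow> (\<exists>C. \<forall>p q. dist (u p) (u q) \<le> C * dist p q powr \<beta>)"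

text \<open>
  For \<open>k = 0\<close> the map itself takes values in the circle and its Hoelder condition uses the circle
  metric. No Hoelder condition is imposed on the inverse.
\<close>

definition hoelder_diffeos :: "nat \<Rightarrow> real \<Rightarrow> (circle \<Rightarrow> circle) set" where
  "hoelder_diffeos k \<beta> =
     (if k = 0 then {f \<in> circle_homeos. hoelder_on_circle \<beta> f}
      else {f \<in> circle_diffeos k. hoelder_on_circle \<beta> (circle_deriv k f)})"

definition regularity_classes :: "(circle \<Rightarrow> circle) set set" where
  "regularity_classes =
     {\<Union>\<beta>\<in>{0<..<1}. hoelder_diffeos 0 \<beta>}
     \<union> {hoelder_diffeos k \<beta> | k \<beta>. 0 < \<beta> \<and> \<beta> < 1}
     \<union> {circle_diffeos k | k. k \<ge> 1}
     \<union> {smooth_diffeos}"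

definition conjugate_by :: "(circle \<Rightarrow> circle) set \<Rightarrow> (circle \<Rightarrow> circle) \<Rightarrow> (circle \<Rightarrow> circle) \<Rightarrow> bool" where
  "conjugate_by D S T \<longleftrightarrow> (\<exists>h\<in>D. S = h \<circ> T \<circ> inv h)"

definition deriv_dist :: "nat \<Rightarrow> (circle \<Rightarrow> circle) \<Rightarrow> (circle \<Rightarrow> circle) \<Rightarrow> real" where
  "deriv_dist i f g =
     (if i = 0 then (SUP p. dist (f p) (g p))
      else (SUP p. \<bar>circle_deriv i f p - circle_deriv i g p\<bar>))"

definition C_k_dist :: "nat \<Rightarrow> (circle \<Rightarrow> circle) \<Rightarrow> (circle \<Rightarrow> circle) \<Rightarrow> real" where
  "C_k_dist k f g = Max ((\<lambda>i. deriv_dist i f g) ` {0..k})"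

definition diffeo_dist :: "nat \<Rightarrow> (circle \<Rightarrow> circle) \<Rightarrow> (circle \<Rightarrow> circle) \<Rightarrow> real" where
  "diffeo_dist k f g = max (C_k_dist k f g) (C_k_dist k (inv f) (inv g))"

text \<open>
  The series starts at order \<open>1\<close>, hence the shift of the summation index. The locale
  \<open>Metric_space\<close> asks for nonnegativity also outside the carrier, where the suprema above may
  be over unbounded sets; hence the conditional.
\<close>
definition smooth_dist :: "(circle \<Rightarrow> circle) \<Rightarrow> (circle \<Rightarrow> circle) \<Rightarrow> real" where
  "smooth_dist f g =
     (if f \<in> smooth_diffeos \<and> g \<in> smooth_diffeos
      then (\<Sum>k. diffeo_dist (Suc k) f g / (2 ^ Suc k * (1 + diffeo_dist (Suc k) f g)))
      else 0)"

lemma smooth_diffeosD: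
  assumes "f \<in> smooth_diffeos"
  shows "C_k_circle k f" "C_k_circle k (inv f)" "bij f"
proof -
  show "C_k_circle k f" "C_k_circle k (inv f)"
    using assms by (auto simp: smooth_diffeos_def circle_diffeos_def)
  obtain g where "homeomorphism UNIV UNIV f g"
    using assms by (auto simp: smooth_diffeos_def circle_diffeos_def circle_homeos_def)
  then show "bij f"
    by (metis UNIV_I bij_iff homeomorphism_def)
qed

definition smooth_map :: "(circle \<Rightarrow> circle) \<Rightarrow> bool" where
  "smooth_map f \<longleftrightarrow> (\<forall>k. C_k_circle k f)"

lemma deriv_dist_commute: "deriv_dist i f g = deriv_dist i g f"
  by (simp add: deriv_dist_def dist_commute abs_minus_commute)

lemma bdd_above_circle_deriv_diff:
  assumes "smooth_map f" "smooth_map g" "i \<ge> 1"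
  shows "bdd_above (range (\<lambda>p. \<bar>circle_deriv i f p - circle_deriv i g p\<bar>))"
proof -
  obtain a where a: "\<And>p. norm (circle_deriv i f p) \<le> a"
    using bounded_circle_deriv[of i f] assms by (auto simp: smooth_map_def bounded_iff)
  obtain b where b: "\<And>p. norm (circle_deriv i g p) \<le> b"
    using bounded_circle_deriv[of i g] assms by (auto simp: smooth_map_def bounded_iff)
  show ?thesis
  proof (rule bdd_aboveI2)
    fix p
    show "\<bar>circle_deriv i f p - circle_deriv i g p\<bar> \<le> a + b"
      using a[of p] b[of p] unfolding real_norm_def by linarith
  qed
qed

lemma bdd_above_circle_dist: "bdd_above (range (\<lambda>p. dist (f p) (g p :: circle)))"
  by (rule bdd_aboveI[of _ "1/2"]) (use dist_circle_le_half in blast)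

lemma deriv_dist_nonneg:
  assumes "smooth_map f" "smooth_map g"
  shows "deriv_dist i f g \<ge> 0"
proof (cases "i = 0")
  case True
  then show ?thesis
    by (auto simp: deriv_dist_def intro: cSUP_upper2[OF bdd_above_circle_dist, of undefined])
next
  case False
  then have "i \<ge> 1" by simp
  from False show ?thesis
    by (auto simp: deriv_dist_def
        intro: cSUP_upper2[OF bdd_above_circle_deriv_diff[OF assms \<open>i \<ge> 1\<close>], of undefined])
qed

lemma deriv_dist_triangle:
  assumes "smooth_map f" "smooth_map g" "smooth_map h"
  shows "deriv_dist i f h \<le> deriv_dist i f g + deriv_dist i g h"
proof (cases "i = 0")
  case True
  have "(SUP p. dist (f p) (h p)) \<le> (SUP p. dist (f p) (g p)) + (SUP p. dist (g p) (h p))"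
  proof (rule cSUP_least)
    fix p
    have "dist (f p) (g p) \<le> (SUP p. dist (f p) (g p))" "dist (g p) (h p) \<le> (SUP p. dist (g p) (h p))"
      by (intro cSUP_upper bdd_above_circle_dist UNIV_I)+
    then show "dist (f p) (h p) \<le> (SUP p. dist (f p) (g p)) + (SUP p. dist (g p) (h p))"
      using dist_triangle[of "f p" "h p" "g p"] by linarith
  qed simp
  then show ?thesis using True by (simp add: deriv_dist_def)
next
  case False
  then have i: "i \<ge> 1" by simp
  let ?d = "\<lambda>f g p. \<bar>circle_deriv i f p - circle_deriv i g p\<bar>"
  have "(SUP p. ?d f h p) \<le> (SUP p. ?d f g p) + (SUP p. ?d g h p)"
  proof (rule cSUP_least)
    fix p
    have "?d f g p \<le> (SUP p. ?d f g p)" "?d g h p \<le> (SUP p. ?d g h p)"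
      by (intro cSUP_upper bdd_above_circle_deriv_diff assms i UNIV_I)+
    then show "?d f h p \<le> (SUP p. ?d f g p) + (SUP p. ?d g h p)" by linarith
  qed simp
  then show ?thesis using False by (simp add: deriv_dist_def)
qed

lemma C_k_dist_ge: "i \<le> k \<Longrightarrow> deriv_dist i f g \<le> C_k_dist k f g"
  unfolding C_k_dist_def by (intro Max_ge) auto

lemma C_k_dist_triangle:
  assumes "smooth_map f" "smooth_map g" "smooth_map h"
  shows "C_k_dist k f h \<le> C_k_dist k f g + C_k_dist k g h"
proof -
  have "deriv_dist i f h \<le> C_k_dist k f g + C_k_dist k g h" if "i \<le> k" for i
    using deriv_dist_triangle[OF assms, of i] C_k_dist_ge[OF that, of f g] C_k_dist_ge[OF that, of g h]
    by linarith
  then show ?thesis unfolding C_k_dist_def[of k f h] by (intro Max.boundedI) auto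
qed

lemma smooth_diffeo_maps:
  assumes "f \<in> smooth_diffeos"
  shows "smooth_map f" "smooth_map (inv f)"
  using smooth_diffeosD[OF assms] by (auto simp: smooth_map_def)

lemma deriv_dist_self: "deriv_dist i f f = 0"
  by (simp add: deriv_dist_def)

lemma diffeo_dist_self: "diffeo_dist k f f = 0"
  by (simp add: diffeo_dist_def C_k_dist_def deriv_dist_self)

lemma diffeo_dist_commute: "diffeo_dist k f g = diffeo_dist k g f"
  by (simp add: diffeo_dist_def C_k_dist_def deriv_dist_commute[of _ f g]
      deriv_dist_commute[of _ "inv f" "inv g"])

lemma diffeo_dist_ge_dist: "dist (f p) (g p) \<le> diffeo_dist k f g"
proof -
  have "dist (f p) (g p) \<le> (SUP p. dist (f p) (g p))"
    by (intro cSUP_upper bdd_above_circle_dist UNIV_I)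
  also have "\<dots> \<le> C_k_dist k f g"
    using C_k_dist_ge[of 0 k f g] by (simp add: deriv_dist_def)
  finally show ?thesis by (simp add: diffeo_dist_def)
qed

lemma diffeo_dist_nonneg: "diffeo_dist k f g \<ge> 0"
  using order_trans[OF zero_le_dist diffeo_dist_ge_dist] .

lemma diffeo_dist_triangle:
  assumes "f \<in> smooth_diffeos" "g \<in> smooth_diffeos" "h \<in> smooth_diffeos"
  shows "diffeo_dist k f h \<le> diffeo_dist k f g + diffeo_dist k g h"
proof -
  have "C_k_dist k f h \<le> C_k_dist k f g + C_k_dist k g h"
    "C_k_dist k (inv f) (inv h) \<le> C_k_dist k (inv f) (inv g) + C_k_dist k (inv g) (inv h)"
    using assms by (simp_all add: C_k_dist_triangle smooth_diffeo_maps)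
  then show ?thesis unfolding diffeo_dist_def by linarith
qed

lemma summable_smooth_dist:
  "summable (\<lambda>k. diffeo_dist (Suc k) f g / (2 ^ Suc k * (1 + diffeo_dist (Suc k) f g)))"
proof (rule summable_comparison_test')
  show "summable (\<lambda>k. (1/2) ^ k :: real)" by (simp add: summable_geometric)
  fix k :: nat
  let ?d = "diffeo_dist (Suc k) f g"
  have d: "?d \<ge> 0" by (rule diffeo_dist_nonneg)
  have "?d / (2 ^ Suc k * (1 + ?d)) = (1/2) ^ Suc k * (?d / (1 + ?d))"
    by (simp add: power_one_over)
  also have "\<dots> \<le> (1/2) ^ k * 1"
    using d by (intro mult_mono) auto
  finally show "norm (?d / (2 ^ Suc k * (1 + ?d))) \<le> (1/2) ^ k"
    using d by simp
qed

lemma ratio_triangle: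
  fixes a b c :: real
  assumes "0 \<le> a" "0 \<le> b" "0 \<le> c" "c \<le> a + b"
  shows "c / (1 + c) \<le> a / (1 + a) + b / (1 + b)"
proof -
  have "c / (1 + c) \<le> (a + b) / (1 + (a + b))"
    using assms by (simp add: divide_simps) (simp add: algebra_simps)
  also have "\<dots> = a / (1 + (a + b)) + b / (1 + (a + b))"
    by (rule add_divide_distrib)
  also have "\<dots> \<le> a / (1 + a) + b / (1 + b)"
    using assms by (intro add_mono divide_left_mono) auto
  finally show ?thesis .
qed

lemma Metric_space_smooth: "Metric_space smooth_diffeos smooth_dist"
proof
  let ?t = "\<lambda>f g k. diffeo_dist (Suc k) f g / (2 ^ Suc k * (1 + diffeo_dist (Suc k) f g))"
  have t_nonneg: "?t f g k \<ge> 0" for f g k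
    by (simp add: diffeo_dist_nonneg)
  fix f g
  show "0 \<le> smooth_dist f g"
  proof (cases "f \<in> smooth_diffeos \<and> g \<in> smooth_diffeos")
    case True
    show ?thesis
      unfolding smooth_dist_def if_P[OF True] by (rule suminf_nonneg[OF summable_smooth_dist t_nonneg])
  qed (auto simp: smooth_dist_def)
  show "smooth_dist f g = smooth_dist g f"
    by (auto simp: smooth_dist_def diffeo_dist_commute[of _ f g])
  show "smooth_dist f g = 0 \<longleftrightarrow> f = g" if fg: "f \<in> smooth_diffeos" "g \<in> smooth_diffeos"
  proof
    assume "smooth_dist f g = 0"
    then have "(\<Sum>k. ?t f g k) = 0"
      using fg by (simp add: smooth_dist_def)
    then have "\<forall>k. ?t f g k = 0"
      using suminf_eq_zero_iff[OF summable_smooth_dist t_nonneg] by blast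
    then have "?t f g 0 = 0" by blast
    then have d: "diffeo_dist 1 f g = 0"
      using diffeo_dist_nonneg[of 1 f g] by auto
    have "f p = g p" for p
      using diffeo_dist_ge_dist[of f p g 1] unfolding d by simp
    then show "f = g" by (rule ext)
  next
    assume "f = g"
    then show "smooth_dist f g = 0" by (simp add: smooth_dist_def diffeo_dist_self)
  qed
  fix h
  show "smooth_dist f h \<le> smooth_dist f g + smooth_dist g h"
    if fgh: "f \<in> smooth_diffeos" "g \<in> smooth_diffeos" "h \<in> smooth_diffeos"
  proof -
    have "?t f h k \<le> ?t f g k + ?t g h k" for k
    proof -
      have "(1/2) ^ Suc k * (diffeo_dist (Suc k) f h / (1 + diffeo_dist (Suc k) f h))
          \<le> (1/2) ^ Suc k * (diffeo_dist (Suc k) f g / (1 + diffeo_dist (Suc k) f g)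
                           + diffeo_dist (Suc k) g h / (1 + diffeo_dist (Suc k) g h))"
        using fgh by (intro mult_left_mono ratio_triangle diffeo_dist_nonneg diffeo_dist_triangle) auto
      then show ?thesis by (simp add: power_one_over distrib_left)
    qed
    then have "(\<Sum>k. ?t f h k) \<le> (\<Sum>k. ?t f g k + ?t g h k)"
      by (intro suminf_le summable_smooth_dist summable_add)
    also have "\<dots> = (\<Sum>k. ?t f g k) + (\<Sum>k. ?t g h k)"
      by (intro suminf_add[symmetric] summable_smooth_dist)
    finally show ?thesis using fgh by (simp add: smooth_dist_def)
  qed
qed

definition smooth_topology :: "(circle \<Rightarrow> circle) topology" where
  "smooth_topology = Metric_space.mtopology smooth_diffeos smooth_dist"

definition smooth_borel :: "(circle \<Rightarrow> circle) measure" where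
  "smooth_borel = sigma smooth_diffeos {U. openin smooth_topology U}"

end

theory Submission
  imports Defs "HOL-Probability.Probability"
begin

text \<open>
  To each 0-1 sequence \<open>a\<close> we attach a smooth diffeomorphism that moves exactly the points of
  disjoint arcs \<open>I\<^sub>0, I\<^sub>1, \<dots>\<close> accumulating at \<open>0\<close>, where \<open>I\<^sub>n\<close> has one of two lengths according to
  \<open>a n\<close>, the shorter being the \<open>(2n + 5)\<close>-th power of the longer. On \<open>I\<^sub>n\<close> the map is an affine copy
  of \<open>x + \<epsilon>\<^sub>n \<beta>(x)\<close> for a fixed bump \<open>\<beta>\<close>, with \<open>\<epsilon>\<^sub>n\<close> so small that the map is smooth and depends
  continuously on \<open>a\<close>. Flipping one digit amounts to conjugating by a smooth diffeomorphism that is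
  affine on one arc and the identity away from it. Hence an invariant, as a function of \<open>a\<close>, is
  invariant under changing finitely many digits, and by Kolmogorov's 0-1 law it is almost surely
  constant for fair coin tossing. So it agrees on some \<open>a\<close> and its complement, which differ at every
  place. But a conjugacy permutes the moved arcs, and counting them shows that it cannot be Hoelder.
\<close>

section \<open>Functions with bounded derivatives\<close>

text \<open>The relation being coded is eventual equality of 0-1 sequences, the standard example
  without a Borel real-valued invariant. Every class \<open>D\<close> lies between the smooth
  diffeomorphisms and the Hoelder homeomorphisms, so producing smooth conjugacies for digit flips
  and excluding Hoelder ones for complements settles all classes at once. The obstacle is that the
  permutation of arcs induced by a conjugacy is unknown, so lengths cannot be compared block by
  block. The lengths are therefore arranged in one decreasing list whose neighbours are separated by
  exponents tending to infinity: whatever the permutation, some arc has to be stretched across such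
  a gap, and one Hoelder exponent cannot permit this for infinitely many gaps. Hoelder continuity is
  at hand for \<open>h\<close> but not for its inverse, so the direction of stretching matters; a
  conjugacy for each order of the two maps takes care of this.\<close>

primrec bounded_derivs :: "nat \<Rightarrow> ('t \<Rightarrow> real \<Rightarrow> real) \<Rightarrow> bool" where
  "bounded_derivs 0 u \<longleftrightarrow> (\<exists>C. \<forall>t x. \<bar>u t x\<bar> \<le> C)"
| "bounded_derivs (Suc k) u \<longleftrightarrow> (\<exists>C. \<forall>t x. \<bar>u t x\<bar> \<le> C) \<and>
     (\<exists>u'. (\<forall>t x. (u t has_real_derivative u' t x) (at x)) \<and> bounded_derivs k u')"

text \<open>All bounds are uniform in the parameter \<open>t\<close>. This matters in
  \<open>small_perturbation\<close>, where \<open>t\<close> is the size of the perturbation.\<close>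

definition smooth_family :: "('t \<Rightarrow> real \<Rightarrow> real) \<Rightarrow> bool" where
  "smooth_family u \<longleftrightarrow> (\<forall>k. bounded_derivs k u)"

abbreviation smooth_bounded :: "(real \<Rightarrow> real) \<Rightarrow> bool" where
  "smooth_bounded f \<equiv> smooth_family (\<lambda>_::unit. f)"

lemma bounded_derivs_bound: "bounded_derivs k u \<Longrightarrow> \<exists>C. \<forall>t x. \<bar>u t x\<bar> \<le> C"
  by (cases k) auto

lemma bounded_derivs_SucI:
  assumes "\<And>t x. (u t has_real_derivative u' t x) (at x)" "bounded_derivs k u'"
    and "\<exists>C. \<forall>t x. \<bar>u t x\<bar> \<le> C"
  shows "bounded_derivs (Suc k) u"
  using assms unfolding bounded_derivs.simps by blast

lemma bounded_derivs_Suc_D: "bounded_derivs (Suc k) u \<Longrightarrow> bounded_derivs k u"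
proof (induction k arbitrary: u)
  case (Suc k)
  then show ?case by (metis bounded_derivs.simps(2))
qed auto

lemma smooth_family_bound:
  assumes "smooth_family u"
  shows "\<exists>C>0. \<forall>t x. \<bar>u t x\<bar> \<le> C"
proof -
  obtain C where C: "\<forall>t x. \<bar>u t x\<bar> \<le> C"
    using assms bounded_derivs_bound unfolding smooth_family_def by blast
  then have "\<forall>t x. \<bar>u t x\<bar> \<le> max C 1" by (simp add: le_max_iff_disj)
  then show ?thesis by (intro exI[of _ "max C 1"]) simp
qed

text \<open>The witnesses \<open>u'\<close> may a priori depend on \<open>k\<close>; uniqueness of
  derivatives identifies them all with \<open>deriv (u t)\<close>.\<close>

lemma smooth_family_deriv:
  assumes "smooth_family u"
  shows "(u t has_real_derivative deriv (u t) x) (at x)" "smooth_family (\<lambda>t. deriv (u t))"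
proof -
  have *: "\<exists>u'. (\<forall>t x. (u t has_real_derivative u' t x) (at x)) \<and> bounded_derivs k u'" for k
    using assms unfolding smooth_family_def by (metis bounded_derivs.simps(2))
  have eq: "u' = (\<lambda>t. deriv (u t))"
    if "\<forall>t x. (u t has_real_derivative u' t x) (at x)" for u'
    using that by (metis DERIV_imp_deriv ext)
  show "(u t has_real_derivative deriv (u t) x) (at x)"
    using *[of 0] eq by metis
  show "smooth_family (\<lambda>t. deriv (u t))"
    unfolding smooth_family_def using * eq by metis
qed

lemma smooth_family_higher_deriv:
  assumes "smooth_family u"
  shows "smooth_family (\<lambda>t. (deriv ^^ i) (u t))"
  by (induction i) (use assms in \<open>auto dest: smooth_family_deriv(2)\<close>)

lemma smooth_family_DERIV_higher:
  assumes "smooth_family u"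
  shows "((deriv ^^ i) (u t) has_real_derivative (deriv ^^ Suc i) (u t) x) (at x)"
  using smooth_family_deriv(1)[OF smooth_family_higher_deriv[OF assms]] by simp

text \<open>Meant for series: the candidates \<open>D i\<close> will be sums of termwise
  derivatives, and linking each order to the next identifies them with the iterated
  derivatives.\<close>

lemma smooth_familyI:
  assumes "\<And>i t x. (D i t has_real_derivative D (Suc i) t x) (at x)"
    and "\<And>i. \<exists>C. \<forall>t x. \<bar>D i t x\<bar> \<le> C"
  shows "smooth_family (D 0)" "(deriv ^^ i) (D 0 t) = D i t"
proof -
  have "bounded_derivs k (D i)" for k i
  proof (induction k arbitrary: i)
    case (Suc k)
    show ?case by (rule bounded_derivs_SucI[OF assms(1) Suc assms(2)])
  qed (use assms in auto)
  then show "smooth_family (D 0)" by (simp add: smooth_family_def)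
  show "(deriv ^^ i) (D 0 t) = D i t"
  proof (induction i)
    case (Suc i)
    show ?case using assms(1)[of i t] Suc by (auto intro!: DERIV_imp_deriv)
  qed simp
qed

lemma smooth_family_index:
  assumes "smooth_family u"
  shows "smooth_family (\<lambda>s. u (g s))"
proof -
  have "bounded_derivs k u \<Longrightarrow> bounded_derivs k (\<lambda>s. u (g s))" for k and u :: "'a \<Rightarrow> real \<Rightarrow> real"
  proof (induction k arbitrary: u)
    case (Suc k)
    then obtain u' where "\<forall>t x. (u t has_real_derivative u' t x) (at x)" "bounded_derivs k u'"
      by auto
    then have "\<And>t x. (u (g t) has_real_derivative u' (g t) x) (at x)"
      "bounded_derivs k (\<lambda>s. u' (g s))" using Suc.IH by auto
    moreover have "\<exists>C. \<forall>t x. \<bar>u (g t) x\<bar> \<le> C" using Suc.prems by auto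
    ultimately show ?case by (rule bounded_derivs_SucI)
  qed auto
  then show ?thesis using assms by (auto simp: smooth_family_def)
qed

lemma smooth_family_const:
  assumes "\<And>t. \<bar>a t\<bar> \<le> C"
  shows "smooth_family (\<lambda>t x. a t)"
proof -
  have zero: "bounded_derivs k (\<lambda>(t::'a) x. 0)" for k
  proof (induction k)
    case (Suc k)
    show ?case by (rule bounded_derivs_SucI[OF _ Suc]) auto
  qed auto
  have "bounded_derivs k (\<lambda>t x. a t)" for k
  proof (cases k)
    case (Suc k)
    show ?thesis unfolding Suc by (rule bounded_derivs_SucI[OF _ zero]) (use assms in auto)
  qed (use assms in auto)
  then show ?thesis by (simp add: smooth_family_def)
qed

lemma bounded_derivs_add:
  "bounded_derivs k u \<Longrightarrow> bounded_derivs k v \<Longrightarrow> bounded_derivs k (\<lambda>t x. u t x + v t x)"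
proof -
  have bd: "\<exists>C. \<forall>t x. \<bar>u t x + v t x\<bar> \<le> C"
    if "\<exists>C. \<forall>t x. \<bar>u t x\<bar> \<le> C" "\<exists>C. \<forall>t x. \<bar>v t x\<bar> \<le> C" for u v :: "'a \<Rightarrow> real \<Rightarrow> real"
    using that by (metis abs_triangle_ineq add_mono order_trans)
  show "bounded_derivs k u \<Longrightarrow> bounded_derivs k v \<Longrightarrow> bounded_derivs k (\<lambda>t x. u t x + v t x)"
  proof (induction k arbitrary: u v)
    case (Suc k)
    from Suc.prems obtain u' v' where
      "\<forall>t x. (u t has_real_derivative u' t x) (at x)" "bounded_derivs k u'"
      "\<forall>t x. (v t has_real_derivative v' t x) (at x)" "bounded_derivs k v'" by auto
    then have "\<And>t x. ((\<lambda>x. u t x + v t x) has_real_derivative u' t x + v' t x) (at x)"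
      "bounded_derivs k (\<lambda>t x. u' t x + v' t x)"
      using Suc.IH by (auto intro!: derivative_eq_intros)
    moreover have "\<exists>C. \<forall>t x. \<bar>u t x + v t x\<bar> \<le> C"
      using Suc.prems by (intro bd) auto
    ultimately show ?case by (rule bounded_derivs_SucI)
  qed (auto intro!: bd)
qed

lemma bounded_derivs_mult:
  "bounded_derivs k u \<Longrightarrow> bounded_derivs k v \<Longrightarrow> bounded_derivs k (\<lambda>t x. u t x * v t x)"
proof -
  have bd: "\<exists>C. \<forall>t x. \<bar>u t x * v t x\<bar> \<le> C"
    if "\<exists>C. \<forall>t x. \<bar>u t x\<bar> \<le> C" "\<exists>C. \<forall>t x. \<bar>v t x\<bar> \<le> C" for u v :: "'a \<Rightarrow> real \<Rightarrow> real"
  proof -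
    from that obtain A B where "\<forall>t x. \<bar>u t x\<bar> \<le> A" "\<forall>t x. \<bar>v t x\<bar> \<le> B" by blast
    then have "\<bar>u t x * v t x\<bar> \<le> A * B" for t x
      unfolding abs_mult by (intro mult_mono) (auto intro: order_trans[OF abs_ge_zero])
    then show ?thesis by blast
  qed
  show "bounded_derivs k u \<Longrightarrow> bounded_derivs k v \<Longrightarrow> bounded_derivs k (\<lambda>t x. u t x * v t x)"
  proof (induction k arbitrary: u v)
    case (Suc k)
    from Suc.prems obtain u' v' where d:
      "\<forall>t x. (u t has_real_derivative u' t x) (at x)" "bounded_derivs k u'"
      "\<forall>t x. (v t has_real_derivative v' t x) (at x)" "bounded_derivs k v'" by auto
    then have "\<And>t x. ((\<lambda>x. u t x * v t x) has_real_derivative u' t x * v t x + u t x * v' t x) (at x)"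
      by (auto intro!: derivative_eq_intros)
    moreover have "bounded_derivs k (\<lambda>t x. u' t x * v t x + u t x * v' t x)"
      using d Suc.prems by (intro bounded_derivs_add Suc.IH) (auto intro!: bounded_derivs_Suc_D simp del: bounded_derivs.simps)
    moreover have "\<exists>C. \<forall>t x. \<bar>u t x * v t x\<bar> \<le> C"
      using Suc.prems by (intro bd) auto
    ultimately show ?case by (rule bounded_derivs_SucI)
  qed (auto intro!: bd)
qed

lemma smooth_family_add:
  "smooth_family u \<Longrightarrow> smooth_family v \<Longrightarrow> smooth_family (\<lambda>t x. u t x + v t x)"
  by (simp add: smooth_family_def bounded_derivs_add)

lemma smooth_family_mult:
  "smooth_family u \<Longrightarrow> smooth_family v \<Longrightarrow> smooth_family (\<lambda>t x. u t x * v t x)"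
  by (simp add: smooth_family_def bounded_derivs_mult)

lemma smooth_family_cmult: "smooth_family u \<Longrightarrow> smooth_family (\<lambda>t x. c * u t x)"
  by (rule smooth_family_mult[OF smooth_family_const[where C="\<bar>c\<bar>"]]) auto

text \<open>Bootstrapping: the derivative \<open>- u' * (1 / u) * (1 / u)\<close> involves
  \<open>1 / u\<close> only up to the order already treated.\<close>

lemma smooth_family_recip:
  assumes "smooth_family u" "c > 0" "\<And>t x. c \<le> u t x"
  shows "smooth_family (\<lambda>t x. 1 / u t x)"
proof -
  have pos: "u t x > 0" for t x using assms(2) assms(3)[of t x] by linarith
  have bd: "\<bar>1 / u t x\<bar> \<le> 1 / c" for t x
    using pos[of t x] assms(2) assms(3)[of t x] by (simp add: frac_le)
  have "bounded_derivs k (\<lambda>t x. 1 / u t x)" for k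
  proof (induction k)
    case 0
    show ?case using bd by auto
  next
    case (Suc k)
    have "((\<lambda>x. 1 / u t x) has_real_derivative
        - 1 * deriv (u t) x * (1 / u t x) * (1 / u t x)) (at x)" for t x
      using pos[of t x]
      by (auto intro!: derivative_eq_intros smooth_family_deriv(1)[OF assms(1)] simp: field_simps)
    moreover have "bounded_derivs k (\<lambda>t x. - 1 * deriv (u t) x)"
      using smooth_family_cmult[OF smooth_family_deriv(2)[OF assms(1)], of "-1"]
      unfolding smooth_family_def by blast
    note bounded_derivs_mult[OF bounded_derivs_mult[OF this Suc] Suc]
    ultimately show ?case using bd by (intro bounded_derivs_SucI) blast+
  qed
  then show ?thesis by (simp add: smooth_family_def)
qed

lemma smooth_family_affine:
  fixes u :: "'a \<Rightarrow> real \<Rightarrow> real"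
  assumes "smooth_family u"
  shows "smooth_family (\<lambda>t x. u t (a * x + b))"
proof -
  have "bounded_derivs k u \<Longrightarrow> bounded_derivs k (\<lambda>t x. u t (a * x + b))"
    for k and u :: "'a \<Rightarrow> real \<Rightarrow> real"
  proof (induction k arbitrary: u)
    case (Suc k)
    from Suc.prems obtain u' where d:
      "\<forall>t x. (u t has_real_derivative u' t x) (at x)" "bounded_derivs k u'" by auto
    have "((\<lambda>x. u t (a * x + b)) has_real_derivative u' t (a * x + b) * a) (at x)" for t x
    proof (rule DERIV_chain2[where f="u t"])
      show "((\<lambda>x. a * x + b) has_real_derivative a) (at x)"
        by (auto intro!: derivative_eq_intros)
    qed (use d(1) in auto)
    moreover have "bounded_derivs k (\<lambda>(t::'a) x. a)"
      using smooth_family_const[of "\<lambda>_::'a. a" "\<bar>a\<bar>"] by (simp add: smooth_family_def)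
    then have "bounded_derivs k (\<lambda>t x. u' t (a * x + b) * a)"
      by (rule bounded_derivs_mult[OF Suc.IH[OF d(2)]])
    moreover have "\<exists>C. \<forall>t x. \<bar>u t (a * x + b)\<bar> \<le> C" using Suc.prems by auto
    ultimately show ?case by (rule bounded_derivs_SucI)
  qed auto
  then show ?thesis using assms by (simp add: smooth_family_def)
qed

lemma DERIV_zero_outside:
  assumes "(f has_real_derivative D) (at x)" "\<And>y. y \<notin> {a..b} \<Longrightarrow> f y = 0" "x \<notin> {a..b}"
  shows "D = 0"
proof -
  have "((\<lambda>_. 0) has_real_derivative D) (at x)"
    by (rule has_field_derivative_transform_within_open[OF assms(1), of "- {a..b}"])
      (use assms in auto)
  then show ?thesis using DERIV_unique[OF _ DERIV_const] by blast
qed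

text \<open>The factor \<open>x\<close> is unbounded, so the product rule for families does not
  apply; the common bounded support replaces boundedness. The derivative \<open>u + x * u'\<close>
  reproduces the same situation.\<close>

lemma smooth_family_ident_mult:
  assumes "smooth_family u" "\<And>t x. x \<notin> {a..b} \<Longrightarrow> u t x = 0"
  shows "smooth_family (\<lambda>t x. x * u t x)"
proof -
  have bd: "\<exists>C. \<forall>t x. \<bar>x * u t x\<bar> \<le> C"
    if u: "\<exists>C. \<forall>t x. \<bar>u t x\<bar> \<le> C" "\<And>t x. x \<notin> {a..b} \<Longrightarrow> u t x = 0"
    for u :: "'a \<Rightarrow> real \<Rightarrow> real"
  proof -
    from u obtain C where C: "\<forall>t x. \<bar>u t x\<bar> \<le> C" by blast
    have "\<bar>x * u t x\<bar> \<le> (\<bar>a\<bar> + \<bar>b\<bar>) * C" for t x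
    proof (cases "x \<in> {a..b}")
      case True
      then have "\<bar>x\<bar> \<le> \<bar>a\<bar> + \<bar>b\<bar>" by auto
      then show ?thesis unfolding abs_mult using C by (intro mult_mono) auto
    next
      case False
      have "0 \<le> C" using C abs_ge_zero order_trans by blast
      then show ?thesis using u(2)[OF False] by simp
    qed
    then show ?thesis by blast
  qed
  have "bounded_derivs k (\<lambda>t x. x * u t x)"
    if "smooth_family u" "\<And>t x. x \<notin> {a..b} \<Longrightarrow> u t x = 0" for k and u :: "'a \<Rightarrow> real \<Rightarrow> real"
    using that
  proof (induction k arbitrary: u)
    case 0
    then show ?case using bd[of u] unfolding smooth_family_def by (metis bounded_derivs.simps(1))
  next
    case (Suc k)
    note d = smooth_family_deriv[OF Suc.prems(1)]
    have "\<And>t x. x \<notin> {a..b} \<Longrightarrow> deriv (u t) x = 0"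
      using DERIV_zero_outside[OF d(1) Suc.prems(2)] by blast
    then have "bounded_derivs k (\<lambda>t x. x * deriv (u t) x)"
      by (intro Suc.IH d)
    then have D: "bounded_derivs k (\<lambda>t x. u t x + x * deriv (u t) x)"
      using Suc.prems(1) by (intro bounded_derivs_add) (auto simp: smooth_family_def)
    have "((\<lambda>x. x * u t x) has_real_derivative u t x + x * deriv (u t) x) (at x)" for t x
      by (auto intro!: derivative_eq_intros d(1))
    moreover note D
    moreover have "\<exists>C. \<forall>t x. \<bar>x * u t x\<bar> \<le> C"
      using bd[of u] Suc.prems bounded_derivs_bound unfolding smooth_family_def by metis
    ultimately show ?case by (rule bounded_derivs_SucI)
  qed
  then show ?thesis using assms by (simp add: smooth_family_def)
qed

text \<open>Only the jumps of \<open>frac\<close> at integers are critical. On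
  \<open>(n - 1, n + 1)\<close> the function \<open>u t (frac y)\<close> equals
  \<open>u t (y - n) + u t (y - n + 1)\<close>, which is smooth. That \<open>deriv (u t)\<close>
  vanishes off the open interval allows iteration.\<close>

lemma smooth_family_periodize_DERIV:
  assumes "smooth_family u" "\<And>t x. x \<notin> {0<..<1} \<Longrightarrow> u t x = 0"
  shows "x \<notin> {0<..<1} \<Longrightarrow> deriv (u t) x = 0"
    and "((\<lambda>x. u t (frac x)) has_real_derivative deriv (u t) (frac x)) (at x)"
proof -
  note d = smooth_family_deriv[OF assms(1)]
  have dcont: "isCont (deriv (u t)) x" for x
    using smooth_family_deriv(1)[OF d(2)] DERIV_isCont by blast
  have d0: "deriv (u t) x = 0" if "x \<notin> {0<..<1}" for x
  proof -
    have *: "deriv (u t) y = 0" if "y \<notin> {0..1}" for y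
      by (rule DERIV_zero_outside[of "u t" _ y 0 1, OF d(1)]) (use that assms(2) in auto)
    \<comment> \<open>By continuity, the derivative at an end point is a one-sided limit of
      zeros.\<close>
    have "deriv (u t) 0 = 0"
    proof (rule tendsto_unique[of "at_left (0::real)"])
      show "(deriv (u t) \<longlongrightarrow> deriv (u t) 0) (at_left 0)"
        using dcont[of 0] by (auto simp: isCont_def intro: tendsto_within_subset)
      show "(deriv (u t) \<longlongrightarrow> 0) (at_left 0)"
        by (rule tendsto_eventually) (auto simp: eventually_at_filter *)
    qed auto
    moreover have "deriv (u t) 1 = 0"
    proof (rule tendsto_unique[of "at_right (1::real)"])
      show "(deriv (u t) \<longlongrightarrow> deriv (u t) 1) (at_right 1)"
        using dcont[of 1] by (auto simp: isCont_def intro: tendsto_within_subset)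
      show "(deriv (u t) \<longlongrightarrow> 0) (at_right 1)"
        by (rule tendsto_eventually) (auto simp: eventually_at_filter *)
    qed auto
    ultimately show ?thesis
      using * that by (metis atLeastAtMost_iff greaterThanLessThan_iff order_le_less)
  qed
  then show "x \<notin> {0<..<1} \<Longrightarrow> deriv (u t) x = 0" .
  have loc: "v (frac y) = v (y - n) + v (y - n + 1)"
    if "real_of_int n - 1 < y" "y < n + 1" "\<And>x. x \<notin> {0<..<1} \<Longrightarrow> v x = 0"
    for v :: "real \<Rightarrow> real" and n :: int and y
  proof (cases "y < n")
    case True
    then have "\<lfloor>y\<rfloor> = n - 1" using that(1) by linarith
    then have "frac y = y - n + 1" by (simp add: frac_def)
    then show ?thesis using True that(3)[of "y - n"] by simp
  next
    case False
    then have "\<lfloor>y\<rfloor> = n" using that(2) by linarith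
    then show ?thesis using False that(3)[of "y - n + 1"] by (simp add: frac_def)
  qed
  define n where "n = \<lfloor>x\<rfloor>"
  have n: "real_of_int n - 1 < x" "x < n + 1" unfolding n_def by linarith+
  have "((\<lambda>x. u t (x - n) + u t (x - n + 1)) has_real_derivative
      deriv (u t) (x - n) + deriv (u t) (x - n + 1)) (at x)"
    by (auto intro!: derivative_eq_intros DERIV_chain2[OF d(1)])
  then have "((\<lambda>x. u t (x - n) + u t (x - n + 1)) has_real_derivative deriv (u t) (frac x)) (at x)"
    using loc[of n x "deriv (u t)", OF n d0] by simp
  then show "((\<lambda>x. u t (frac x)) has_real_derivative deriv (u t) (frac x)) (at x)"
    by (rule has_field_derivative_transform_within_open[of _ _ _ "{real_of_int n - 1 <..< n + 1}"])
      (use n loc[of n _ "u t", OF _ _ assms(2)] in auto)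
qed

lemma smooth_family_periodize:
  assumes "smooth_family u" "\<And>t x. x \<notin> {0<..<1} \<Longrightarrow> u t x = 0"
  shows "smooth_family (\<lambda>t x. u t (frac x))"
proof -
  have "bounded_derivs k (\<lambda>t x. u t (frac x))"
    if "smooth_family u" "\<And>t x. x \<notin> {0<..<1} \<Longrightarrow> u t x = 0" for k and u :: "'a \<Rightarrow> real \<Rightarrow> real"
    using that
  proof (induction k arbitrary: u)
    case 0
    then show ?case unfolding smooth_family_def bounded_derivs.simps(1)
      using bounded_derivs_bound by metis
  next
    case (Suc k)
    note d = smooth_family_periodize_DERIV[OF Suc.prems]
    have "bounded_derivs k (\<lambda>t x. deriv (u t) (frac x))"
      by (intro Suc.IH d(1) smooth_family_deriv(2) Suc.prems)
    moreover have "\<exists>C. \<forall>t x. \<bar>u t (frac x)\<bar> \<le> C"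
      using Suc.prems(1) bounded_derivs_bound unfolding smooth_family_def by blast
    moreover have "((\<lambda>x. u t (frac x)) has_real_derivative deriv (u t) (frac x)) (at x)" for t x
      by (rule d(2))
    ultimately show ?case by (intro bounded_derivs_SucI[of "\<lambda>t x. u t (frac x)"])
  qed
  then show ?thesis using assms by (simp add: smooth_family_def)
qed

section \<open>Inverses of perturbations of the identity\<close>

lemma smooth_family_higher_bound:
  assumes "smooth_family u"
  shows "\<exists>C>0. \<forall>i\<le>n. \<forall>t x. \<bar>(deriv ^^ i) (u t) x\<bar> \<le> C"
proof (induction n)
  case 0
  then show ?case using smooth_family_bound[OF assms] by simp
next
  case (Suc n)
  then obtain C where C: "C > 0" "\<forall>i\<le>n. \<forall>t x. \<bar>(deriv ^^ i) (u t) x\<bar> \<le> C" by blast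
  obtain B where B: "B > 0" "\<forall>t x. \<bar>(deriv ^^ Suc n) (u t) x\<bar> \<le> B"
    using smooth_family_bound[OF smooth_family_higher_deriv[OF assms, of "Suc n"]] by blast
  have "\<bar>(deriv ^^ i) (u t) x\<bar> \<le> max B C" if "i \<le> Suc n" for i t x
    using that B(2) C(2) unfolding le_Suc_eq by (auto simp: le_max_iff_disj simp del: funpow.simps)
  then show ?case using B(1) by (intro exI[of _ "max B C"]) auto
qed

lemma higher_deriv_cmult_family:
  assumes "smooth_family u"
  shows "(deriv ^^ i) (\<lambda>x. c * u t x) = (\<lambda>x. c * (deriv ^^ i) (u t) x)"
proof (induction i)
  case (Suc i)
  have "((\<lambda>x. c * (deriv ^^ i) (u t) x) has_real_derivative c * (deriv ^^ Suc i) (u t) x) (at x)" for x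
    by (intro DERIV_cmult smooth_family_DERIV_higher[OF assms])
  then show ?case using Suc by (auto intro!: DERIV_imp_deriv)
qed simp

lemma strict_mono_perturbation:
  assumes "smooth_family \<psi>" "c > 0" "\<And>x. c \<le> 1 + deriv (\<psi> t) x"
  shows "strict_mono (\<lambda>x. x + \<psi> t x)"
    and "x \<le> y \<Longrightarrow> c * (y - x) \<le> (y + \<psi> t y) - (x + \<psi> t x)"
    and "bij (\<lambda>x. x + \<psi> t x)"
proof -
  have D: "((\<lambda>x. x + \<psi> t x) has_real_derivative 1 + deriv (\<psi> t) x) (at x)" for x
    by (auto intro!: derivative_eq_intros smooth_family_deriv(1)[OF assms(1)])
  have gap: "c * (y - x) \<le> (y + \<psi> t y) - (x + \<psi> t x)" if "x \<le> y" for x y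
  proof (cases "x = y")
    case False
    then obtain z where "(y + \<psi> t y) - (x + \<psi> t x) = (y - x) * (1 + deriv (\<psi> t) z)"
      using MVT2[of x y "\<lambda>x. x + \<psi> t x" "\<lambda>x. 1 + deriv (\<psi> t) x"] D \<open>x \<le> y\<close> by auto
    then show ?thesis using assms(3)[of z] that by (metis diff_ge_0_iff_ge mult.commute mult_left_mono)
  qed simp
  then show "x \<le> y \<Longrightarrow> c * (y - x) \<le> (y + \<psi> t y) - (x + \<psi> t x)" .
  show mono: "strict_mono (\<lambda>x. x + \<psi> t x)"
  proof (rule strict_monoI)
    fix x y :: real assume "x < y"
    then have "0 < c * (y - x)" using assms(2) by simp
    then show "x + \<psi> t x < y + \<psi> t y" using gap[of x y] \<open>x < y\<close> by linarith
  qed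
  obtain C where C: "C > 0" "\<forall>s x. \<bar>\<psi> s x\<bar> \<le> C"
    using smooth_family_bound[OF assms(1)] by blast
  have "\<exists>x. x + \<psi> t x = y" for y
  proof -
    have cont: "isCont (\<lambda>x. x + \<psi> t x) x" for x using D DERIV_isCont by blast
    \<comment> \<open>\<open>C\<close> bounds the perturbation, so the values at
      \<open>y - C\<close> and \<open>y + C\<close> lie on either side of \<open>y\<close>.\<close>
    have "\<exists>x. y - C \<le> x \<and> x \<le> y + C \<and> x + \<psi> t x = y"
      using C(2)[THEN spec, THEN spec, of t "y - C"] C(2)[THEN spec, THEN spec, of t "y + C"] C(1) cont
      by (intro IVT) (auto simp: abs_le_iff)
    then show ?thesis by blast
  qed
  then show "bij (\<lambda>x. x + \<psi> t x)"
    using strict_mono_imp_inj_on[OF mono] unfolding bij_def surj_def by metis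
qed

definition perturbation_inverse :: "(real \<Rightarrow> real) \<Rightarrow> real \<Rightarrow> real" where
  "perturbation_inverse u = inv (\<lambda>x. x + u x)"

text \<open>
  The inverse \<open>G\<close> of \<open>x + \<psi> x\<close> satisfies \<open>G' = 1 / (1 + \<psi>' \<circ> G)\<close>, hence
  \<open>(f \<circ> G)' = (f' / (1 + \<psi>')) \<circ> G\<close> and smoothness bootstraps.
\<close>

lemma smooth_family_compose_inverse:
  fixes \<psi> :: "'a \<Rightarrow> real \<Rightarrow> real"
  assumes "smooth_family \<psi>" "c > 0" "\<And>t x. c \<le> 1 + deriv (\<psi> t) x" "smooth_family f"
  shows "smooth_family (\<lambda>t x. f t (perturbation_inverse (\<psi> t) x))"
proof -
  define G where "G t = perturbation_inverse (\<psi> t)" for t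
  note sm = strict_mono_perturbation[OF assms(1-3)]
  have G: "G t x + \<psi> t (G t x) = x" for t x
    using bij_inv_eq_iff[OF sm(3)[of t]] unfolding G_def perturbation_inverse_def by metis
  \<comment> \<open>The rule for derivatives of inverse functions presupposes continuity of
    \<open>G t\<close>; expansion by the factor \<open>c\<close> makes \<open>G t\<close>
    Lipschitz.\<close>
  have Glip: "\<bar>G t x - G t y\<bar> \<le> \<bar>x - y\<bar> / c" for t x y
  proof -
    have *: "c * (b - a) \<le> (b + \<psi> t b) - (a + \<psi> t a)" if "a \<le> b" for a b using sm(2)[OF that] .
    have "c * \<bar>G t x - G t y\<bar> \<le> \<bar>x - y\<bar>"
      using *[of "G t x" "G t y"] *[of "G t y" "G t x"] G[of t x] G[of t y]
      by (cases "G t x \<le> G t y") (auto simp: abs_if)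
    then show ?thesis using assms(2) by (simp add: field_simps)
  qed
  have Gcont: "isCont (G t) x" for t x
  proof -
    have "(1 / c)-lipschitz_on UNIV (G t)"
      using Glip assms(2) by (intro lipschitz_onI) (auto simp: dist_real_def)
    then show ?thesis
      using lipschitz_on_continuous_on continuous_on_eq_continuous_at by blast
  qed
  have GD: "(G t has_real_derivative 1 / (1 + deriv (\<psi> t) (G t x))) (at x)" for t x
  proof -
    have "(G t has_real_derivative inverse (1 + deriv (\<psi> t) (G t x))) (at x)"
    proof (rule DERIV_inverse_function[of "\<lambda>x. x + \<psi> t x" _ _ _ "x - 1" "x + 1"])
      show "((\<lambda>x. x + \<psi> t x) has_real_derivative 1 + deriv (\<psi> t) (G t x)) (at (G t x))"
        by (auto intro!: derivative_eq_intros smooth_family_deriv(1)[OF assms(1)])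
      show "1 + deriv (\<psi> t) (G t x) \<noteq> 0" using assms(2) assms(3)[of t "G t x"] by linarith
    qed (use G Gcont in auto)
    then show ?thesis by (simp add: inverse_eq_divide)
  qed
  have one: "smooth_family (\<lambda>(t::'a) x::real. 1)" by (rule smooth_family_const[of _ 1]) simp
  have q: "smooth_family (\<lambda>t x. 1 / (1 + deriv (\<psi> t) x))"
    by (rule smooth_family_recip[OF _ assms(2,3)], rule smooth_family_add[OF one])
      (rule smooth_family_deriv(2)[OF assms(1)])
  have "bounded_derivs k (\<lambda>t x. f t (G t x))" if "smooth_family f" for k and f :: "'a \<Rightarrow> real \<Rightarrow> real"
    using that
  proof (induction k arbitrary: f)
    case 0
    show ?case using smooth_family_bound[OF 0] by auto
  next
    case (Suc k)
    have "((\<lambda>x. f t (G t x)) has_real_derivative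
        deriv (f t) (G t x) * (1 / (1 + deriv (\<psi> t) (G t x)))) (at x)" for t x
      by (rule DERIV_chain2[OF smooth_family_deriv(1)[OF Suc.prems] GD])
    moreover have "bounded_derivs k (\<lambda>t x. deriv (f t) (G t x) * (1 / (1 + deriv (\<psi> t) (G t x))))"
      by (rule Suc.IH[OF smooth_family_mult[OF smooth_family_deriv(2)[OF Suc.prems] q]])
    moreover have "\<exists>C. \<forall>t x. \<bar>f t (G t x)\<bar> \<le> C"
      using smooth_family_bound[OF Suc.prems] by blast
    ultimately show ?case by (rule bounded_derivs_SucI)
  qed
  then show ?thesis using assms(4) unfolding smooth_family_def G_def by blast
qed

lemma perturbation_inverse:
  assumes "bij (\<lambda>x. x + u x)"
  shows "perturbation_inverse u (x + u x) = x"
    and "perturbation_inverse u x + u (perturbation_inverse u x) = x"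
  using bij_inv_eq_iff[OF assms] unfolding perturbation_inverse_def by metis+

text \<open>The inverse \<open>G\<close> satisfies \<open>G x - x = - \<psi> (G x)\<close>, which is
  bounded with all its derivatives although \<open>G\<close> is not.\<close>

lemma smooth_perturbation_inverse:
  assumes "smooth_bounded \<psi>" "c > 0" "\<And>x. c \<le> 1 + deriv \<psi> x"
  shows "smooth_bounded (\<lambda>x. perturbation_inverse \<psi> x - x)"
proof -
  have b: "bij (\<lambda>x. x + \<psi> x)" using strict_mono_perturbation(3)[OF assms(1,2)] assms(3) by blast
  have "smooth_bounded (\<lambda>x. -1 * \<psi> (perturbation_inverse \<psi> x))"
    by (rule smooth_family_cmult, rule smooth_family_compose_inverse[OF assms(1,2) _ assms(1)])
      (rule assms(3))
  moreover have "-1 * \<psi> (perturbation_inverse \<psi> x) = perturbation_inverse \<psi> x - x" for x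
    using perturbation_inverse(2)[OF b, of x] by linarith
  ultimately show ?thesis by simp
qed

text \<open>The inverse displacement is \<open>- \<epsilon> * \<theta> \<epsilon> x\<close>, where
  \<open>\<theta> t\<close> is \<open>\<psi>\<close> composed with the inverse of the perturbation
  of size \<open>t\<close>. With \<open>t\<close> as the parameter of a smooth family, the
  derivatives of \<open>\<theta> t\<close> are bounded uniformly in \<open>t\<close>, so the factor
  \<open>\<epsilon>\<close> alone makes everything small.\<close>

lemma small_perturbation:
  fixes n :: nat
  assumes "smooth_bounded \<psi>" "\<eta> > 0"
  shows "\<exists>e>0. \<forall>\<epsilon>. 0 < \<epsilon> \<and> \<epsilon> \<le> e \<longrightarrow>
    (\<forall>x. 1/2 \<le> 1 + deriv (\<lambda>x. \<epsilon> * \<psi> x) x) \<and>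
    (\<forall>i\<le>n. \<forall>x. \<bar>(deriv ^^ i) (\<lambda>x. \<epsilon> * \<psi> x) x\<bar> \<le> \<eta> \<and>
      \<bar>(deriv ^^ i) (\<lambda>x. perturbation_inverse (\<lambda>x. \<epsilon> * \<psi> x) x - x) x\<bar> \<le> \<eta>)"
proof -
  obtain C1 where C1: "C1 > 0" "\<forall>x. \<bar>deriv \<psi> x\<bar> \<le> C1"
    using smooth_family_bound[OF smooth_family_deriv(2)[OF assms(1)]] by blast
  \<comment> \<open>Up to scale \<open>e0\<close> the derivative of the perturbation is at most 1/2
    in absolute value.\<close>
  define e0 where "e0 = 1 / (2 * C1)"
  have e0: "e0 > 0" using C1 by (simp add: e0_def)
  \<comment> \<open>Clamping the scale extends the family to all real parameters without losing the
    bounds.\<close>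
  define cl where "cl t = max 0 (min t e0)" for t :: real
  have cl: "0 \<le> cl t" "cl t \<le> e0" for t using e0 by (auto simp: cl_def)
  define \<Psi> where "\<Psi> t x = cl t * \<psi> x" for t x
  have s\<psi>: "smooth_family (\<lambda>t::real. \<psi>)" using smooth_family_index[OF assms(1)] .
  have s: "smooth_family \<Psi>"
    unfolding \<Psi>_def by (rule smooth_family_mult[OF smooth_family_const[of cl e0] s\<psi>]) (use cl in auto)
  have d: "deriv (\<Psi> t) x = cl t * deriv \<psi> x" for t x
    using higher_deriv_cmult_family[OF assms(1), of 1 "cl t"] by (simp add: \<Psi>_def[abs_def])
  have half: "1/2 \<le> 1 + deriv (\<Psi> t) x" for t x
  proof -
    have "\<bar>cl t * deriv \<psi> x\<bar> \<le> e0 * C1"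
      unfolding abs_mult using cl[of t] C1 e0 by (intro mult_mono) auto
    also have "\<dots> = 1/2" using C1 by (simp add: e0_def)
    finally show ?thesis unfolding d by linarith
  qed
  define \<theta> where "\<theta> t x = \<psi> (perturbation_inverse (\<Psi> t) x)" for t x
  have s\<theta>: "smooth_family \<theta>"
    unfolding \<theta>_def by (rule smooth_family_compose_inverse[OF s _ half s\<psi>]) simp
  obtain C where C: "C > 0" "\<forall>i\<le>n. \<forall>t x. \<bar>(deriv ^^ i) (\<theta> t) x\<bar> \<le> C"
    using smooth_family_higher_bound[OF s\<theta>, of n] by auto
  obtain B where B: "B > 0" "\<forall>i\<le>n. \<forall>x. \<bar>(deriv ^^ i) \<psi> x\<bar> \<le> B"
    using smooth_family_higher_bound[OF assms(1), of n] by auto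
  define e where "e = min e0 (\<eta> / (B + C))"
  have "e > 0" using e0 assms(2) B C by (simp add: e_def)
  moreover have "(\<forall>x. 1/2 \<le> 1 + deriv (\<lambda>x. \<epsilon> * \<psi> x) x) \<and>
    (\<forall>i\<le>n. \<forall>x. \<bar>(deriv ^^ i) (\<lambda>x. \<epsilon> * \<psi> x) x\<bar> \<le> \<eta> \<and>
      \<bar>(deriv ^^ i) (\<lambda>x. perturbation_inverse (\<lambda>x. \<epsilon> * \<psi> x) x - x) x\<bar> \<le> \<eta>)"
    if \<epsilon>: "0 < \<epsilon>" "\<epsilon> \<le> e" for \<epsilon>
  proof -
    have cle: "cl \<epsilon> = \<epsilon>" using \<epsilon> by (simp add: cl_def e_def)
    then have eq: "(\<lambda>x. \<epsilon> * \<psi> x) = \<Psi> \<epsilon>" by (simp add: \<Psi>_def[abs_def])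
    have b: "bij (\<lambda>x. x + \<Psi> \<epsilon> x)" using strict_mono_perturbation(3)[OF s _ half] by simp
    have w: "(\<lambda>x. perturbation_inverse (\<Psi> \<epsilon>) x - x) = (\<lambda>x. - \<epsilon> * \<theta> \<epsilon> x)"
    proof
      fix x
      have "\<Psi> \<epsilon> (perturbation_inverse (\<Psi> \<epsilon>) x) = \<epsilon> * \<theta> \<epsilon> x" by (simp add: \<Psi>_def \<theta>_def cle)
      then show "perturbation_inverse (\<Psi> \<epsilon>) x - x = - \<epsilon> * \<theta> \<epsilon> x"
        using perturbation_inverse(2)[OF b, of x] by linarith
    qed
    have eta: "\<epsilon> * K \<le> \<eta>" if "0 \<le> K" "K \<le> B + C" for K
    proof -
      have "\<epsilon> * K \<le> \<eta> / (B + C) * (B + C)"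
        using that \<epsilon> by (intro mult_mono) (auto simp: e_def)
      then show ?thesis using B C by simp
    qed
    have "\<bar>(deriv ^^ i) (\<lambda>x. \<epsilon> * \<psi> x) x\<bar> \<le> \<eta>" if "i \<le> n" for i x
      using higher_deriv_cmult_family[OF assms(1), of i \<epsilon>] B C that \<epsilon>
      by (simp add: abs_mult) (rule eta, simp, rule order_trans[of _ B], auto)
    moreover have "\<bar>(deriv ^^ i) (\<lambda>x. - \<epsilon> * \<theta> \<epsilon> x) x\<bar> \<le> \<eta>" if "i \<le> n" for i x
      unfolding higher_deriv_cmult_family[OF s\<theta>] using B C that \<epsilon>
      by (simp add: abs_mult) (rule eta, simp, rule order_trans[of _ C], auto)
    ultimately show ?thesis using half unfolding eq w by blast
  qed
  ultimately show ?thesis by blast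
qed

section \<open>Bumps and local affine contractions\<close>

text \<open>For \<open>p = 0\<close> this is the classical flat function. The powers of
  \<open>1 / x\<close> make the family closed under differentiation up to linear
  combinations.\<close>

definition flat_exp :: "nat \<Rightarrow> real \<Rightarrow> real" where
  "flat_exp p x = (if x > 0 then (1 / x) ^ p * exp (- (1 / x)) else 0)"

lemma power_le_fact_exp:
  fixes y :: real
  assumes "y \<ge> 0"
  shows "y ^ m \<le> fact m * exp y"
proof -
  have "(\<Sum>n\<in>{m}. y ^ n /\<^sub>R fact n) \<le> exp y"
    unfolding exp_def by (rule sum_le_suminf[OF summable_exp_generic]) (use assms in auto)
  then show ?thesis by (simp add: field_simps)
qed

text \<open>Put \<open>y = 1 / x\<close> in \<open>y ^ (p + m) \<le> fact (p + m) * exp y\<close>.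
  The case \<open>m = 0\<close> gives boundedness, \<open>m = 2\<close> differentiability at
  0.\<close>

lemma flat_exp_bound: "\<bar>flat_exp p x\<bar> \<le> fact (p + m) * \<bar>x\<bar> ^ m"
proof (cases "x > 0")
  case True
  then have "(1 / x) ^ (p + m) \<le> fact (p + m) * exp (1 / x)"
    by (intro power_le_fact_exp) auto
  then have "(1 / x) ^ (p + m) * x ^ m * exp (- (1 / x)) \<le>
      fact (p + m) * exp (1 / x) * x ^ m * exp (- (1 / x))"
    using True by (intro mult_right_mono) auto
  moreover have "(1 / x) ^ (p + m) * x ^ m = (1 / x) ^ p"
    using True by (simp add: power_add power_one_over)
  moreover have "fact (p + m) * exp (1 / x) * x ^ m * exp (- (1 / x)) = fact (p + m) * x ^ m"
    by (simp add: exp_minus field_simps)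
  ultimately show ?thesis using True by (simp add: flat_exp_def abs_mult)
qed (simp add: flat_exp_def)

lemma flat_exp_DERIV:
  "(flat_exp p has_real_derivative flat_exp (p + 2) x - p * flat_exp (p + 1) x) (at x)"
proof (cases x "0 :: real" rule: linorder_cases)
  case less
  have "((\<lambda>_. 0) has_real_derivative 0) (at x)" by simp
  then have "(flat_exp p has_real_derivative 0) (at x)"
    by (rule has_field_derivative_transform_within_open[of _ _ _ "{..<0}"])
      (use less in \<open>auto simp: flat_exp_def\<close>)
  then show ?thesis using less by (simp add: flat_exp_def)
next
  case equal
  have "(\<lambda>y. flat_exp p y / y) \<midarrow>0\<rightarrow> 0"
  proof (rule Lim_null_comparison)
    show "\<forall>\<^sub>F y in at 0. norm (flat_exp p y / y) \<le> fact (p + 2) * \<bar>y\<bar>"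
    proof (rule always_eventually, rule allI)
      fix y :: real
      have "\<bar>flat_exp p y\<bar> \<le> fact (p + 2) * \<bar>y\<bar> * \<bar>y\<bar>"
        using flat_exp_bound[of p y 2] by (simp add: power2_eq_square mult.assoc)
      then show "norm (flat_exp p y / y) \<le> fact (p + 2) * \<bar>y\<bar>"
        by (cases "y = 0") (auto simp: field_simps)
    qed
    have "(\<lambda>y::real. fact (p + 2) * \<bar>y\<bar>) \<midarrow>0\<rightarrow> fact (p + 2) * \<bar>0\<bar>"
      by (intro tendsto_intros)
    then show "(\<lambda>y::real. fact (p + 2) * \<bar>y\<bar>) \<midarrow>0\<rightarrow> 0" by simp
  qed
  then show ?thesis using equal by (simp add: has_field_derivative_iff flat_exp_def)
next
  case greater
  have "((\<lambda>x. (1 / x) ^ p * exp (- (1 / x))) has_real_derivative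
      (real p * (1 / x) ^ (p - Suc 0) * (- (1 / (x * x)))) * exp (- (1 / x)) +
      (1 / x) ^ p * (exp (- (1 / x)) * (1 / (x * x)))) (at x)"
    using greater by (auto intro!: derivative_eq_intros)
  moreover have "(real p * (1 / x) ^ (p - Suc 0) * (- (1 / (x * x)))) * exp (- (1 / x)) +
      (1 / x) ^ p * (exp (- (1 / x)) * (1 / (x * x))) = flat_exp (p + 2) x - p * flat_exp (p + 1) x"
    using greater by (cases p) (simp_all add: flat_exp_def algebra_simps add_divide_distrib)
  ultimately have "((\<lambda>x. (1 / x) ^ p * exp (- (1 / x))) has_real_derivative
      flat_exp (p + 2) x - p * flat_exp (p + 1) x) (at x)" by simp
  then show ?thesis
    by (rule has_field_derivative_transform_within_open[of _ _ _ "{0<..}"])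
      (use greater in \<open>auto simp: flat_exp_def\<close>)
qed

lemma smooth_flat_exp: "smooth_bounded (flat_exp p)"
proof -
  have "bounded_derivs k (\<lambda>_::unit. flat_exp p)" for k
  proof (induction k arbitrary: p)
    case 0
    show ?case using flat_exp_bound[of p _ 0] by auto
  next
    case (Suc k)
    have c: "bounded_derivs k (\<lambda>(_::unit) (_::real). - real p)"
      using smooth_family_const[of "\<lambda>_. - real p" "real p"] by (auto simp: smooth_family_def)
    have "bounded_derivs k (\<lambda>_::unit. \<lambda>x. flat_exp (p + 2) x + - real p * flat_exp (p + 1) x)"
      by (rule bounded_derivs_add[OF Suc bounded_derivs_mult[OF c Suc]])
    moreover have "\<exists>C. \<forall>t x. \<bar>flat_exp p x\<bar> \<le> C" using flat_exp_bound[of p _ 0] by auto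
    ultimately show ?case
      using flat_exp_DERIV[of p]
      by (intro bounded_derivs_SucI[of "\<lambda>_. flat_exp p"
            "\<lambda>_ x. flat_exp (p + 2) x + - real p * flat_exp (p + 1) x"]) auto
  qed
  then show ?thesis by (simp add: smooth_family_def)
qed

definition smooth_step :: "real \<Rightarrow> real" where
  "smooth_step x = flat_exp 0 x * (1 / (flat_exp 0 x + flat_exp 0 (1 - x)))"

definition unit_bump :: "real \<Rightarrow> real" where
  "unit_bump x = flat_exp 0 x * flat_exp 0 (1 - x)"

lemma flat_exp_0: "flat_exp 0 x \<ge> 0" "x > 0 \<Longrightarrow> flat_exp 0 x > 0" "x \<le> 0 \<Longrightarrow> flat_exp 0 x = 0"
  by (auto simp: flat_exp_def)

lemma mono_flat_exp_0: "x \<le> y \<Longrightarrow> flat_exp 0 x \<le> flat_exp 0 y"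
  by (auto simp: flat_exp_def intro!: divide_left_mono)

lemma smooth_flat_exp_reflected: "smooth_bounded (\<lambda>x. flat_exp 0 (1 - x))"
  using smooth_family_affine[OF smooth_flat_exp[of 0], of "-1" 1] by (simp add: algebra_simps)

lemma smooth_unit_bump: "smooth_bounded unit_bump"
  unfolding unit_bump_def[abs_def]
  by (rule smooth_family_mult[OF smooth_flat_exp smooth_flat_exp_reflected])

lemma unit_bump_pos: "x \<in> {0<..<1} \<Longrightarrow> unit_bump x > 0"
  and unit_bump_zero: "x \<notin> {0<..<1} \<Longrightarrow> unit_bump x = 0"
  by (auto simp: unit_bump_def flat_exp_0 not_less)

text \<open>One of \<open>x\<close> and \<open>1 - x\<close> is at least 1/2. The denominator of
  \<open>smooth_step\<close> is thus bounded away from 0, as the rule for reciprocals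
  demands.\<close>

lemma flat_exp_sum_ge: "exp (- 2) \<le> flat_exp 0 x + flat_exp 0 (1 - x)"
proof -
  have h: "flat_exp 0 (1/2) = exp (- 2)" by (simp add: flat_exp_def)
  show ?thesis
  proof (cases "x \<ge> 1/2")
    case True
    then show ?thesis using mono_flat_exp_0[of "1/2" x] flat_exp_0(1)[of "1 - x"] h by linarith
  next
    case False
    then show ?thesis using mono_flat_exp_0[of "1/2" "1 - x"] flat_exp_0(1)[of x] h by linarith
  qed
qed

lemma smooth_smooth_step: "smooth_bounded smooth_step"
  unfolding smooth_step_def[abs_def]
  by (rule smooth_family_mult[OF smooth_flat_exp smooth_family_recip[of _ "exp (- 2)"]])
    (auto intro!: smooth_family_add smooth_flat_exp smooth_flat_exp_reflected flat_exp_sum_ge)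

lemma smooth_step_0: "x \<le> 0 \<Longrightarrow> smooth_step x = 0"
  and smooth_step_1: "x \<ge> 1 \<Longrightarrow> smooth_step x = 1"
  using flat_exp_0(2)[of x] by (auto simp: smooth_step_def flat_exp_0(3))

lemma mono_smooth_step: "x \<le> y \<Longrightarrow> smooth_step x \<le> smooth_step y"
proof -
  assume "x \<le> y"
  define a b c d where "a = flat_exp 0 x" "b = flat_exp 0 (1 - x)" "c = flat_exp 0 y" "d = flat_exp 0 (1 - y)"
  note defs = this
  have ab: "a + b > 0" and cd: "c + d > 0"
    using flat_exp_sum_ge[of x] flat_exp_sum_ge[of y] exp_gt_zero[of "-2::real"] unfolding defs by linarith+
  have "a * d \<le> c * b"
    unfolding defs using \<open>x \<le> y\<close> by (intro mult_mono mono_flat_exp_0 flat_exp_0) auto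
  then have "a * (1 / (a + b)) \<le> c * (1 / (c + d))"
    using ab cd by (simp add: divide_simps algebra_simps)
  then show ?thesis by (simp add: smooth_step_def defs)
qed

lemma smooth_step_range: "0 \<le> smooth_step x" "smooth_step x \<le> 1"
  using mono_smooth_step[of "min x 0" x] mono_smooth_step[of x "max x 1"]
  by (simp_all add: smooth_step_0 smooth_step_1)

text \<open>Modulo 1, \<open>x + \<psi> x\<close> contracts \<open>[c, c + r]\<close> towards
  \<open>c\<close> by the factor \<open>\<mu>\<close> and is the identity outside a margin. However
  small \<open>\<mu>\<close> is, cutting off keeps the derivative above it: the cutoff rises to the
  left of \<open>c\<close> and falls to the right, so its derivative contributes with the favourable
  sign.\<close>

lemma affine_contraction:
  fixes c r \<mu> :: real
  assumes "r > 0" "0 < \<mu>" "\<mu> \<le> 1" "0 \<le> c - r" "c + 2 * r \<le> 1"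
  obtains \<psi> where "smooth_bounded \<psi>" "\<And>x. frac x \<notin> {c - r<..<c + 2 * r} \<Longrightarrow> \<psi> x = 0"
    "\<And>x. \<psi> (frac x) = \<psi> x" "\<And>x. \<mu> \<le> 1 + deriv \<psi> x"
    "\<And>x. frac x \<in> {c..c + r} \<Longrightarrow> \<psi> x = (\<mu> - 1) * (frac x - c)"
proof -
  \<comment> \<open>\<open>A\<close> climbs from 0 to 1 on \<open>[c - r, c]\<close>, and
    \<open>B\<close> falls from 1 to 0 on \<open>[c + r, c + 2 * r]\<close>.\<close>
  define A where "A x = smooth_step ((1 / r) * x + (r - c) / r)" for x
  define B where "B x = smooth_step ((- 1 / r) * x + (c + 2 * r) / r)" for x
  have A_eq: "A x = smooth_step ((x - c) / r + 1)" for x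
    using assms(1) by (simp add: A_def field_simps)
  have B_eq: "B x = smooth_step ((c + r - x) / r + 1)" for x
  proof -
    have "(- 1 / r) * x + (c + 2 * r) / r = (c + r - x) / r + 1"
      using assms(1) by (simp add: divide_simps)
    then show ?thesis by (simp only: B_def)
  qed
  define cut where "cut x = A x * B x" for x
  have scut: "smooth_bounded cut"
    unfolding cut_def[abs_def] A_def[abs_def] B_def[abs_def]
    by (intro smooth_family_mult smooth_family_affine[of "\<lambda>_. smooth_step"] smooth_smooth_step)
  have cut0: "cut x = 0" if "x \<notin> {c - r<..<c + 2 * r}" for x
  proof (cases "x \<le> c - r")
    case True
    then have "A x = 0" unfolding A_eq using assms(1) by (intro smooth_step_0) (simp add: field_simps)
    then show ?thesis by (simp add: cut_def)
  next
    case False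
    then have "B x = 0" unfolding B_eq using assms(1) that by (intro smooth_step_0) (simp add: field_simps)
    then show ?thesis by (simp add: cut_def)
  qed
  have A1: "A x = 1" if "x \<ge> c" for x
    unfolding A_eq using assms(1) that by (intro smooth_step_1) simp
  have B1: "B x = 1" if "x \<le> c + r" for x
    unfolding B_eq using assms(1) that by (intro smooth_step_1) simp
  have range: "0 \<le> cut x" "cut x \<le> 1" for x
    unfolding cut_def A_def B_def
    using smooth_step_range by (auto intro!: mult_nonneg_nonneg mult_le_one)
  have cut_right: "cut y \<le> cut x" if "c \<le> x" "x \<le> y" for x y
    using that assms(1) by (auto simp: cut_def A1 B_eq intro!: mono_smooth_step divide_right_mono)
  have cut_left: "cut x \<le> cut y" if "y \<le> c" "x \<le> y" for x y
    using that assms(1) by (auto simp: cut_def B1 A_eq intro!: mono_smooth_step divide_right_mono)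
  \<comment> \<open>The product is expanded so that \<open>smooth_family_ident_mult\<close> covers
    the term with the unbounded factor \<open>x\<close>.\<close>
  define u where "u x = (\<mu> - 1) * (x * cut x + - c * cut x)" for x
  have u_eq: "u x = (\<mu> - 1) * ((x - c) * cut x)" for x by (simp add: u_def algebra_simps)
  have su: "smooth_bounded u"
    unfolding u_def[abs_def]
    by (intro smooth_family_cmult smooth_family_add scut
        smooth_family_ident_mult[of "\<lambda>_. cut" "c - r" "c + 2 * r"]) (auto simp: cut0)
  have u0: "u x = 0" if "x \<notin> {0<..<1}" for x
    using cut0[of x] that assms by (auto simp: u_eq)
  \<comment> \<open>Monotonicity gives the derivative bound without differentiating the cutoff.
    Neither \<open>\<bar>x - c\<bar>\<close> nor \<open>1 - cut x\<close> decreases as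
    \<open>x\<close> moves away from \<open>c\<close> on either side.\<close>
  have mono: "x + u x - \<mu> * x \<le> y + u y - \<mu> * y" if "x \<le> y" for x y
  proof -
    have eq: "x + u x - \<mu> * x = (1 - \<mu>) * ((x - c) * (1 - cut x) + c)" for x
      by (simp add: u_eq algebra_simps)
    have "(x - c) * (1 - cut x) \<le> (y - c) * (1 - cut y)"
    proof -
      consider "c \<le> x" | "x \<le> c" "c \<le> y" | "y \<le> c" using that by linarith
      then show ?thesis
      proof cases
        case 1
        then show ?thesis using that cut_right[of x y] range[of x] by (intro mult_mono) auto
      next
        case 2
        have "(x - c) * (1 - cut x) \<le> 0" "0 \<le> (y - c) * (1 - cut y)"
          using 2 range[of x] range[of y] by (auto intro: mult_nonpos_nonneg)
        then show ?thesis by linarith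
      next
        case 3
        then have "(c - y) * (1 - cut y) \<le> (c - x) * (1 - cut x)"
          using that cut_left[of y x] range[of y] range[of x] by (intro mult_mono) auto
        then show ?thesis by (simp add: algebra_simps)
      qed
    qed
    then show ?thesis unfolding eq using assms by (intro mult_left_mono) auto
  qed
  have du: "\<mu> \<le> 1 + deriv u x" for x
  proof -
    have "((\<lambda>x. x + u x - \<mu> * x) has_real_derivative 1 + deriv u x - \<mu>) (at x)"
      by (auto intro!: derivative_eq_intros smooth_family_deriv(1)[OF su])
    then have "0 \<le> 1 + deriv u x - \<mu>"
      using mono by (intro mono_on_imp_deriv_nonneg[of UNIV "\<lambda>x. x + u x - \<mu> * x"])
        (auto intro!: mono_onI)
    then show ?thesis by simp
  qed
  show ?thesis
  proof (rule that[of "\<lambda>x. u (frac x)"])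
    show "smooth_bounded (\<lambda>x. u (frac x))"
      by (rule smooth_family_periodize[OF su u0])
    show "u (frac (frac x)) = u (frac x)" for x by simp
    show "u (frac x) = 0" if "frac x \<notin> {c - r<..<c + 2 * r}" for x
      using cut0[OF that] by (simp add: u_eq)
    show "\<mu> \<le> 1 + deriv (\<lambda>x. u (frac x)) x" for x
      using du DERIV_imp_deriv[OF smooth_family_periodize_DERIV(2)[OF su u0]] by simp
    show "u (frac x) = (\<mu> - 1) * (frac x - c)" if "frac x \<in> {c..c + r}" for x
      using that by (simp add: u_eq cut_def A1 B1)
  qed
qed

section \<open>Perturbations of the identity on the circle\<close>

definition periodic1 :: "(real \<Rightarrow> real) \<Rightarrow> bool" where
  "periodic1 u \<longleftrightarrow> (\<forall>x. u (frac x) = u x)"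

definition circle_perturbation :: "(real \<Rightarrow> real) \<Rightarrow> circle \<Rightarrow> circle" where
  "circle_perturbation u p = to_circle (rep_circle p + u (rep_circle p))"

lemma periodic1_Ints: "periodic1 u \<Longrightarrow> m \<in> \<int> \<Longrightarrow> u (x + m) = u x"
proof -
  assume "periodic1 u" "m \<in> \<int>"
  then obtain n where "m = of_int n" by (auto elim: Ints_cases)
  then have "frac (x + m) = frac x" by (simp add: frac_def)
  then show ?thesis using \<open>periodic1 u\<close> unfolding periodic1_def by metis
qed

lemma periodic1I:
  assumes "\<And>x n. u (x + of_int n) = u x"
  shows "periodic1 u"
  unfolding periodic1_def frac_def
proof
  fix x show "u (x - of_int \<lfloor>x\<rfloor>) = u x" using assms[of x "- \<lfloor>x\<rfloor>"] by simp
qed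

lemma circle_perturbation_to_circle:
  assumes "periodic1 u"
  shows "circle_perturbation u (to_circle x) = to_circle (x + u x)"
proof -
  define m where "m = rep_circle (to_circle x) - x"
  have "to_circle (rep_circle (to_circle x)) = to_circle x" by simp
  then have m: "m \<in> \<int>" unfolding m_def to_circle_eq_iff .
  have "rep_circle (to_circle x) = x + m" by (simp add: m_def)
  then have "circle_perturbation u (to_circle x) = to_circle (x + m + u x)"
    using periodic1_Ints[OF assms m] by (simp add: circle_perturbation_def)
  also have "\<dots> = to_circle (x + u x)" using m by (simp add: to_circle_eq_iff)
  finally show ?thesis .
qed

lemma smooth_bounded_continuous: "smooth_bounded u \<Longrightarrow> continuous_on A u"
  using smooth_family_deriv(1) DERIV_continuous_on has_field_derivative_at_within by metis

lemma is_lift_circle_perturbation: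
  assumes "smooth_bounded u" "periodic1 u"
  shows "is_lift (\<lambda>x. x + u x) (circle_perturbation u)"
  unfolding is_lift_def
  using circle_perturbation_to_circle[OF assms(2)]
  by (auto intro!: continuous_on_add continuous_on_id smooth_bounded_continuous[OF assms(1)])

lemma is_lift_continuous:
  assumes "is_lift F f"
  shows "continuous_on UNIV f"
proof -
  have F: "continuous_on UNIV F" "\<And>x. to_circle (F x) = f (to_circle x)"
    using assms by (auto simp: is_lift_def)
  have "open (f -` U)" if "open U" for U
  proof -
    have "continuous_on UNIV (\<lambda>x. to_circle (F x))"
      by (rule continuous_on_compose2[OF continuous_to_circle F(1)]) auto
    then have "open ((\<lambda>x. to_circle (F x)) -` U)"
      using that by (simp add: continuous_on_open_vimage)
    also have "(\<lambda>x. to_circle (F x)) -` U = to_circle -` (f -` U)"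
      using F(2) by auto
    finally show ?thesis by (simp only: open_circle_iff)
  qed
  then show ?thesis by (simp add: continuous_on_open_vimage)
qed

lemma higher_deriv_ident_add:
  assumes "smooth_bounded u"
  shows "(deriv ^^ i) (\<lambda>x. x + u x) =
    (\<lambda>x. (if i = 0 then x else if i = 1 then 1 else 0) + (deriv ^^ i) u x)"
proof (induction i)
  case (Suc i)
  have "((\<lambda>x. (if i = 0 then x else if i = 1 then 1 else 0) + (deriv ^^ i) u x) has_real_derivative
      (if Suc i = 1 then 1 else 0) + (deriv ^^ Suc i) u x) (at x)" for x
    using smooth_family_DERIV_higher[OF assms, of i]
    by (cases "i = 0"; cases "i = 1") (auto intro!: derivative_eq_intros)
  then have "deriv (\<lambda>x. (if i = 0 then x else if i = 1 then 1 else 0) + (deriv ^^ i) u x) =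
      (\<lambda>x. (if Suc i = 1 then 1 else 0) + (deriv ^^ Suc i) u x)"
    by (auto intro!: DERIV_imp_deriv)
  then show ?case using Suc by simp
qed simp

lemma C_k_circle_perturbation:
  assumes "smooth_bounded u" "periodic1 u"
  shows "C_k_circle k (circle_perturbation u)"
proof -
  have D: "((deriv ^^ i) (\<lambda>x. x + u x) has_real_derivative
      (if i = 0 then 1 else 0) + (deriv ^^ Suc i) u x) (at x)" for i x
    unfolding higher_deriv_ident_add[OF assms(1)]
    using smooth_family_DERIV_higher[OF assms(1), of i]
    by (cases "i = 0"; cases "i = 1") (auto intro!: derivative_eq_intros)
  have "continuous_on UNIV ((deriv ^^ k) (\<lambda>x. x + u x))"
    using D[of k] DERIV_isCont continuous_at_imp_continuous_on by blast
  then have "C_k_real k (\<lambda>x. x + u x)"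
    using D unfolding C_k_real_def real_differentiable_def by blast
  then show ?thesis using is_lift_circle_perturbation[OF assms] by (auto simp: C_k_circle_def)
qed

abbreviation inverse_displacement :: "(real \<Rightarrow> real) \<Rightarrow> real \<Rightarrow> real" where
  "inverse_displacement u \<equiv> (\<lambda>x. perturbation_inverse u x - x)"

lemma periodic1_inverse_displacement:
  assumes "periodic1 u" "bij (\<lambda>x. x + u x)"
  shows "periodic1 (inverse_displacement u)"
proof (rule periodic1I)
  fix x :: real and n :: int
  define G where "G = perturbation_inverse u"
  have "G (x + n) = G ((G x + n) + u (G x + n))"
    using perturbation_inverse(2)[OF assms(2), of x] periodic1_Ints[OF assms(1), of n "G x"]
    by (simp add: G_def algebra_simps)
  also have "\<dots> = G x + n" using perturbation_inverse(1)[OF assms(2)] by (simp add: G_def)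
  finally show "inverse_displacement u (x + n) = inverse_displacement u x" by (simp add: G_def)
qed

lemma
  assumes "smooth_bounded u" "periodic1 u" "c > 0" "\<And>x. c \<le> 1 + deriv u x"
  shows circle_perturbation_smooth_diffeo: "circle_perturbation u \<in> smooth_diffeos"
    and inv_circle_perturbation:
      "inv (circle_perturbation u) = circle_perturbation (inverse_displacement u)"
proof -
  define w where "w = inverse_displacement u"
  note sm = strict_mono_perturbation[OF assms(1,3,4)]
  have w: "smooth_bounded w" "periodic1 w"
    using smooth_perturbation_inverse[OF assms(1,3,4)] periodic1_inverse_displacement[OF assms(2) sm(3)]
    by (auto simp: w_def)
  note ct = circle_perturbation_to_circle[OF assms(2)] circle_perturbation_to_circle[OF w(2)]
  have 1: "circle_perturbation u (circle_perturbation w p) = p" for p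
    by (rule circle.abs_induct) (simp add: ct, simp add: w_def perturbation_inverse[OF sm(3)])
  have 2: "circle_perturbation w (circle_perturbation u p) = p" for p
    by (rule circle.abs_induct) (simp add: ct, simp add: w_def perturbation_inverse[OF sm(3)])
  show inv: "inv (circle_perturbation u) = circle_perturbation (inverse_displacement u)"
    using 1 2 unfolding w_def by (intro inv_equality) auto
  have "homeomorphism UNIV UNIV (circle_perturbation u) (circle_perturbation w)"
    using 1 2 is_lift_continuous is_lift_circle_perturbation[OF assms(1,2)] is_lift_circle_perturbation[OF w]
    unfolding homeomorphism_def by (auto simp: surj_def) metis+
  then have "circle_perturbation u \<in> circle_homeos"
    unfolding circle_homeos_def using is_lift_circle_perturbation[OF assms(1,2)] sm(1) by auto
  then show "circle_perturbation u \<in> smooth_diffeos"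
    using C_k_circle_perturbation[OF assms(1,2)] C_k_circle_perturbation[OF w]
    unfolding smooth_diffeos_def circle_diffeos_def by (auto simp: inv w_def)
qed

section \<open>Estimates in the smooth metric\<close>

lemma deriv_dist_circle_perturbation:
  assumes "smooth_bounded u" "periodic1 u" "smooth_bounded v" "periodic1 v"
    and "\<And>x. \<bar>(deriv ^^ i) u x - (deriv ^^ i) v x\<bar> \<le> \<eta>"
  shows "deriv_dist i (circle_perturbation u) (circle_perturbation v) \<le> \<eta>"
proof (cases "i = 0")
  case True
  have "dist (circle_perturbation u p) (circle_perturbation v p) \<le> \<eta>" for p
    using dist_to_circle_le[of "rep_circle p + u (rep_circle p)" "rep_circle p + v (rep_circle p)"]
      assms(5)[of "rep_circle p"] True
    by (simp add: circle_perturbation_def dist_real_def)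
  then show ?thesis using True by (auto simp: deriv_dist_def intro: cSUP_least)
next
  case False
  have "\<bar>circle_deriv i (circle_perturbation u) p - circle_deriv i (circle_perturbation v) p\<bar> \<le> \<eta>" for p
  proof -
    define x where "x = rep_circle p"
    have p: "p = to_circle x" by (simp add: x_def)
    show ?thesis
      using assms(5)[of x] False unfolding p
      by (simp add: circle_deriv_eq[OF is_lift_circle_perturbation[OF assms(1,2)]]
          circle_deriv_eq[OF is_lift_circle_perturbation[OF assms(3,4)]]
          higher_deriv_ident_add[OF assms(1)] higher_deriv_ident_add[OF assms(3)])
  qed
  then show ?thesis using False by (auto simp: deriv_dist_def intro: cSUP_least)
qed

lemma half_powers_tail_sums: "(\<lambda>n. if n < N then 0 else (1/2) ^ Suc n) sums ((1/2::real) ^ N)"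
proof -
  have "(\<lambda>n. (1/2) ^ N * (1/2) ^ Suc n) sums ((1/2::real) ^ N * 1)"
    by (intro sums_mult power_half_series)
  then have "(\<lambda>n. if n + N < N then 0 else (1/2) ^ Suc (n + N)) sums
      ((1/2::real) ^ N - (\<Sum>n<N. if n < N then 0 else (1/2) ^ Suc n))"
    by (simp add: power_add mult_ac)
  then show ?thesis by (subst (asm) sums_iff_shift) simp
qed

text \<open>Split the series at \<open>N\<close>: terms of index below \<open>N\<close> involve the
  orders 1 to \<open>N\<close> and add up to at most \<open>\<eta>\<close>; the others are bounded
  by their weights, whose sum is \<open>(1/2) ^ N\<close>.\<close>

lemma smooth_dist_le:
  assumes "f \<in> smooth_diffeos" "g \<in> smooth_diffeos" "\<And>k. k \<le> N \<Longrightarrow> diffeo_dist k f g \<le> \<eta>"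
  shows "smooth_dist f g \<le> \<eta> + (1/2) ^ N"
proof -
  have \<eta>: "\<eta> \<ge> 0" using assms(3)[of 0] diffeo_dist_nonneg[of 0 f g] by simp
  let ?d = "\<lambda>k. diffeo_dist (Suc k) f g"
  let ?r = "\<lambda>k. \<eta> * (1/2) ^ Suc k + (if k < N then 0 else (1/2) ^ Suc k)"
  have "?d k / (2 ^ Suc k * (1 + ?d k)) \<le> ?r k" for k
  proof -
    have d: "0 \<le> ?d k" by (rule diffeo_dist_nonneg)
    have eq: "?d k / (2 ^ Suc k * (1 + ?d k)) = (1/2) ^ Suc k * (?d k / (1 + ?d k))"
      by (simp add: power_one_over)
    have "?d k / (1 + ?d k) \<le> ?d k" "?d k / (1 + ?d k) \<le> 1"
      using d by (auto simp: divide_simps algebra_simps)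
    then have "?d k / (1 + ?d k) \<le> (if k < N then \<eta> else 1)"
      using assms(3)[of "Suc k"] by auto
    then have "(1/2) ^ Suc k * (?d k / (1 + ?d k)) \<le> (1/2) ^ Suc k * (if k < N then \<eta> else 1)"
      by (intro mult_left_mono) auto
    also have "\<dots> \<le> ?r k" using \<eta> by auto
    finally show ?thesis unfolding eq .
  qed
  moreover have s: "?r sums (\<eta> * 1 + (1/2) ^ N)"
    by (intro sums_add sums_mult power_half_series half_powers_tail_sums)
  ultimately have "(\<Sum>k. ?d k / (2 ^ Suc k * (1 + ?d k))) \<le> suminf ?r"
    using sums_summable[OF s] by (intro suminf_le summable_smooth_dist)
  also have "\<dots> = \<eta> + (1/2) ^ N" using sums_unique[OF s] by simp
  finally show ?thesis using assms(1,2) by (simp add: smooth_dist_def)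
qed

section \<open>Series with rapidly decreasing derivatives\<close>

definition small_bumps :: "(nat \<Rightarrow> real \<Rightarrow> real) \<Rightarrow> bool" where
  "small_bumps b \<longleftrightarrow> (\<forall>n. smooth_bounded (b n) \<and>
     (\<forall>i\<le>Suc n. \<forall>x. \<bar>(deriv ^^ i) (b n) x\<bar> \<le> (1/2) ^ Suc (Suc n)))"

text \<open>For a fixed order the geometric bound holds for all but finitely many \<open>n\<close>,
  and the exceptional terms are bounded individually. So the Weierstrass test applies at every order
  and permits termwise differentiation.\<close>

lemma small_bumps_series:
  assumes "small_bumps b"
  shows "smooth_bounded (\<lambda>x. \<Sum>n. b n x)"
    and "(deriv ^^ i) (\<lambda>x. \<Sum>n. b n x) x = (\<Sum>n. (deriv ^^ i) (b n) x)"
    and "summable (\<lambda>n. (deriv ^^ i) (b n) x)"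
proof -
  have sb: "smooth_bounded (b n)" for n using assms by (auto simp: small_bumps_def)
  have small: "\<bar>(deriv ^^ i) (b n) x\<bar> \<le> (1/2) ^ Suc (Suc n)" if "i \<le> Suc n" for i n x
    using assms that unfolding small_bumps_def by blast
  have "\<exists>M. summable M \<and> (\<forall>n x. \<bar>(deriv ^^ i) (b n) x\<bar> \<le> M n)" for i
  proof -
    have "\<forall>n. \<exists>C. \<forall>x. \<bar>(deriv ^^ i) (b n) x\<bar> \<le> C"
      using smooth_family_bound[OF smooth_family_higher_deriv[OF sb]] by blast
    then obtain C where C: "\<And>n x. \<bar>(deriv ^^ i) (b n) x\<bar> \<le> C n" by metis
    define M where "M n = (if i \<le> Suc n then (1/2) ^ Suc (Suc n) else C n)" for n
    have "summable (\<lambda>n. (1/2::real) ^ Suc (Suc n))"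
      using summable_geometric[of "1/2::real"] by simp
    moreover have "\<forall>\<^sub>F n in sequentially. (1/2::real) ^ Suc (Suc n) = M n"
      using eventually_ge_at_top[of i] by eventually_elim (simp add: M_def)
    ultimately have "summable M"
      using summable_cong[of "\<lambda>n. (1/2) ^ Suc (Suc n)" M] by blast
    then show ?thesis using C small by (intro exI[of _ M]) (auto simp: M_def simp del: power_Suc)
  qed
  then obtain M where M: "\<And>i. summable (M i)" "\<And>i n x. \<bar>(deriv ^^ i) (b n) x\<bar> \<le> M i n" by metis
  have summ: "summable (\<lambda>n. (deriv ^^ i) (b n) x)" for i x
    by (rule summable_comparison_test'[OF M(1)[of i], of 0]) (use M(2) in auto)
  then show "summable (\<lambda>n. (deriv ^^ i) (b n) x)" .
  define D where "D i t x = (\<Sum>n. (deriv ^^ i) (b n) x)" for i and t :: unit and x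
  have "(D i t has_real_derivative D (Suc i) t x) (at x)" for i t x
    unfolding D_def
  proof (rule has_field_derivative_series'(2)[of UNIV "\<lambda>n. (deriv ^^ i) (b n)" "\<lambda>n. (deriv ^^ Suc i) (b n)" x])
    show "uniformly_convergent_on UNIV (\<lambda>n x. \<Sum>k<n. (deriv ^^ Suc i) (b k) x)"
      using M(2)[of "Suc i"] M(1)[of "Suc i"]
      by (intro Weierstrass_m_test'[of _ _ "M (Suc i)"]) (auto simp del: funpow.simps)
    show "((deriv ^^ i) (b n) has_real_derivative (deriv ^^ Suc i) (b n) y) (at y within UNIV)" for n y
      using smooth_family_DERIV_higher[OF sb, of i n y] by simp
  qed (use summ in auto)
  moreover have "\<exists>C. \<forall>t x. \<bar>D i t x\<bar> \<le> C" for i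
  proof -
    have "\<bar>D i t x\<bar> \<le> suminf (M i)" for t x
      unfolding D_def using norm_suminf_le[of "\<lambda>n. (deriv ^^ i) (b n) x" "M i"] M by auto
    then show ?thesis by blast
  qed
  ultimately have "smooth_family (D 0)" "(deriv ^^ i) (D 0 ()) = D i ()"
    by (rule smooth_familyI)+
  then show "smooth_bounded (\<lambda>x. \<Sum>n. b n x)"
    "(deriv ^^ i) (\<lambda>x. \<Sum>n. b n x) x = (\<Sum>n. (deriv ^^ i) (b n) x)"
    by (auto simp: D_def[abs_def])
qed

text \<open>Only terms with \<open>n \<ge> N\<close> survive, and there
  \<open>i \<le> N \<le> n\<close> puts both derivatives within the controlled range. Two bounds
  \<open>(1/2) ^ (n + 2)\<close> make \<open>(1/2) ^ (n + 1)\<close>, whose tail from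
  \<open>N\<close> on sums to \<open>(1/2) ^ N\<close>.\<close>

lemma small_bumps_series_diff:
  assumes "small_bumps b" "small_bumps b'" "\<And>n. n < N \<Longrightarrow> b n = b' n" "i \<le> N"
  shows "\<bar>(deriv ^^ i) (\<lambda>x. \<Sum>n. b n x) x - (deriv ^^ i) (\<lambda>x. \<Sum>n. b' n x) x\<bar> \<le> (1/2) ^ N"
proof -
  let ?f = "\<lambda>n. (deriv ^^ i) (b n) x - (deriv ^^ i) (b' n) x"
  let ?g = "\<lambda>n. if n < N then 0 else (1/2::real) ^ Suc n"
  have "\<bar>?f n\<bar> \<le> ?g n" for n
  proof (cases "n < N")
    case False
    then have "\<bar>(deriv ^^ i) (b n) x\<bar> \<le> (1/2) ^ Suc (Suc n)" "\<bar>(deriv ^^ i) (b' n) x\<bar> \<le> (1/2) ^ Suc (Suc n)"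
      using assms(1,2,4) unfolding small_bumps_def by auto
    then have "\<bar>?f n\<bar> \<le> (1/2) ^ Suc (Suc n) + (1/2) ^ Suc (Suc n)"
      using abs_triangle_ineq4[of "(deriv ^^ i) (b n) x" "(deriv ^^ i) (b' n) x"] by linarith
    then show ?thesis using False by simp
  qed (use assms(3) in simp)
  then have "\<bar>\<Sum>n. ?f n\<bar> \<le> suminf ?g"
    using norm_suminf_le[of ?f ?g] sums_summable[OF half_powers_tail_sums] by auto
  also have "\<dots> = (1/2) ^ N" using sums_unique[OF half_powers_tail_sums[of N]] by simp
  also have "(\<Sum>n. ?f n) = (\<Sum>n. (deriv ^^ i) (b n) x) - (\<Sum>n. (deriv ^^ i) (b' n) x)"
    using small_bumps_series(3)[OF assms(1)] small_bumps_series(3)[OF assms(2)] by (intro suminf_diff[symmetric])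
  finally show ?thesis by (simp add: small_bumps_series(2)[OF assms(1)] small_bumps_series(2)[OF assms(2)])
qed

section \<open>A family of diffeomorphisms indexed by 0-1 sequences\<close>

text \<open>The number \<open>2 * n + of_bool i\<close> ranks all lengths in one decreasing list.
  Factorial exponents make each length a power of its predecessor, with exponents tending to
  infinity. The summand 4 keeps an arc within a quarter of the length of its block.\<close>

definition bump_length :: "nat \<Rightarrow> bool \<Rightarrow> real" where
  "bump_length n i = (1/2) ^ fact (2 * n + of_bool i + 4)"

text \<open>In units of \<open>(1/2) ^ (n + 4)\<close> the block is \<open>(4, 8)\<close>, the arc
  starts at 5 and its length \<open>r\<close> is at most 1. This leaves room for the range from
  \<open>5 - r\<close> to \<open>5 + 2 * r\<close> that an affine contraction occupies.\<close>

definition bump_start :: "nat \<Rightarrow> real" where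
  "bump_start n = (1/2) ^ (n + 2) + (1/2) ^ (n + 4)"

definition block :: "nat \<Rightarrow> real set" where
  "block n = {x. frac x \<in> {(1/2) ^ (n + 2)<..<(1/2) ^ (n + 1)}}"

text \<open>Scaling the height along with the width makes the maps
  \<open>x + e * scaled_bump n i x\<close> for the two digits affine copies of each other with the
  same \<open>e\<close>.\<close>

definition scaled_bump :: "nat \<Rightarrow> bool \<Rightarrow> real \<Rightarrow> real" where
  "scaled_bump n i x = bump_length n i * unit_bump ((frac x - bump_start n) / bump_length n i)"

lemma bump_length_pos: "bump_length n i > 0"
  by (simp add: bump_length_def)

lemma bump_length_mono:
  assumes "2 * n + of_bool i \<le> 2 * m + of_bool j"
  shows "bump_length m j \<le> bump_length n i"
  unfolding bump_length_def using assms by (intro power_decreasing fact_mono) auto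

lemma bump_length_le: "bump_length n i \<le> (1/2) ^ (n + 4)"
proof -
  have "n + 4 \<le> 2 * n + of_bool i + 4" by simp
  also have "\<dots> \<le> fact (2 * n + of_bool i + 4)" by (rule fact_ge_self)
  finally show ?thesis unfolding bump_length_def by (intro power_decreasing) auto
qed

lemma bump_interval_bounds:
  "(1/2) ^ (n + 2) \<le> bump_start n - bump_length n i"
  "bump_start n + 2 * bump_length n i < (1/2) ^ (n + 1)"
  "(1/2::real) ^ (n + 1) \<le> 1/2"
proof -
  have p: "(1/2::real) ^ (n + 4) > 0" by simp
  have e: "(1/2::real) ^ (n + 2) = 4 * (1/2) ^ (n + 4)" "(1/2::real) ^ (n + 1) = 8 * (1/2) ^ (n + 4)"
    by (simp_all add: power_one_over power_add)
  show "(1/2) ^ (n + 2) \<le> bump_start n - bump_length n i"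
    using bump_length_le[of n i] by (simp add: bump_start_def)
  show "bump_start n + 2 * bump_length n i < (1/2) ^ (n + 1)"
    using bump_length_le[of n i] p unfolding bump_start_def e by linarith
  show "(1/2::real) ^ (n + 1) \<le> 1/2" using power_le_one[of "1/2::real" n] by simp
qed

lemma bump_start_pos: "bump_start n > 0"
  unfolding bump_start_def by (intro add_pos_pos) auto

lemma block_disjoint:
  assumes "x \<in> block n" "x \<in> block m"
  shows "n = m"
proof (rule ccontr)
  have *: False if "x \<in> block n" "x \<in> block m" "n < m" for n m
  proof -
    have "(1/2::real) ^ (m + 1) \<le> (1/2) ^ (n + 2)" using that(3) by (intro power_decreasing) auto
    then show False using that(1,2) by (auto simp: block_def)
  qed
  assume "n \<noteq> m"
  then show False using *[of n m] *[of m n] assms by linarith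
qed

lemma scaled_bump_zero: "frac x \<notin> {bump_start n<..<bump_start n + bump_length n i} \<Longrightarrow> scaled_bump n i x = 0"
  and scaled_bump_pos: "frac x \<in> {bump_start n<..<bump_start n + bump_length n i} \<Longrightarrow> scaled_bump n i x > 0"
  using bump_length_pos[of n i]
  by (auto simp: scaled_bump_def divide_simps intro!: unit_bump_zero unit_bump_pos mult_pos_pos)

lemma smooth_scaled_bump: "smooth_bounded (scaled_bump n i)"
proof -
  let ?l = "bump_length n i" and ?c = "bump_start n"
  let ?u = "\<lambda>x. ?l * unit_bump ((1 / ?l) * x + (- ?c / ?l))"
  have eq: "(1 / ?l) * x + (- ?c / ?l) = (x - ?c) / ?l" for x by (simp add: diff_divide_distrib)
  have "?u x = 0" if "x \<notin> {0<..<1}" for x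
  proof -
    have "?c + ?l < 1"
      using bump_length_pos[of n i] bump_interval_bounds(2)[of n i] bump_interval_bounds(3)[of n]
      by linarith
    then have "(x - ?c) / ?l \<notin> {0<..<1}"
      using that bump_length_pos[of n i] bump_start_pos[of n] by (auto simp: divide_simps)
    then show ?thesis unfolding eq by (simp add: unit_bump_zero)
  qed
  moreover have "smooth_bounded ?u"
    by (rule smooth_family_cmult[OF smooth_family_affine[OF smooth_unit_bump]])
  ultimately have "smooth_bounded (\<lambda>x. ?u (frac x))" by (intro smooth_family_periodize[of "\<lambda>_. ?u"])
  then show ?thesis unfolding eq scaled_bump_def[abs_def] .
qed

text \<open>One scale has to serve both digits, since the affine copies match only for equal scales.
  The top order \<open>Suc n\<close> includes first derivatives already at
  \<open>n = 0\<close>.\<close>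

definition admissible_scale :: "nat \<Rightarrow> real \<Rightarrow> bool" where
  "admissible_scale n e \<longleftrightarrow> e > 0 \<and> (\<forall>i.
    (\<forall>x. 1/2 \<le> 1 + deriv (\<lambda>x. e * scaled_bump n i x) x) \<and>
    (\<forall>k\<le>Suc n. \<forall>x. \<bar>(deriv ^^ k) (\<lambda>x. e * scaled_bump n i x) x\<bar> \<le> (1/2) ^ Suc (Suc n) \<and>
      \<bar>(deriv ^^ k) (inverse_displacement (\<lambda>x. e * scaled_bump n i x)) x\<bar> \<le> (1/2) ^ Suc (Suc n)))"

definition bump_scale :: "nat \<Rightarrow> real" where
  "bump_scale n = (SOME e. admissible_scale n e)"

definition bump :: "nat \<Rightarrow> bool \<Rightarrow> real \<Rightarrow> real" where
  "bump n i = (\<lambda>x. bump_scale n * scaled_bump n i x)"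

lemma admissible_bump_scale: "admissible_scale n (bump_scale n)"
proof -
  have p: "(1/2::real) ^ Suc (Suc n) > 0" by simp
  obtain e1 where e1: "e1 > 0" "\<forall>\<epsilon>. 0 < \<epsilon> \<and> \<epsilon> \<le> e1 \<longrightarrow>
    (\<forall>x. 1/2 \<le> 1 + deriv (\<lambda>x. \<epsilon> * scaled_bump n True x) x) \<and>
    (\<forall>i\<le>Suc n. \<forall>x. \<bar>(deriv ^^ i) (\<lambda>x. \<epsilon> * scaled_bump n True x) x\<bar> \<le> (1/2) ^ Suc (Suc n) \<and>
      \<bar>(deriv ^^ i) (inverse_displacement (\<lambda>x. \<epsilon> * scaled_bump n True x)) x\<bar> \<le> (1/2) ^ Suc (Suc n))"
    using small_perturbation[OF smooth_scaled_bump p, of n True "Suc n"] by blast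
  obtain e2 where e2: "e2 > 0" "\<forall>\<epsilon>. 0 < \<epsilon> \<and> \<epsilon> \<le> e2 \<longrightarrow>
    (\<forall>x. 1/2 \<le> 1 + deriv (\<lambda>x. \<epsilon> * scaled_bump n False x) x) \<and>
    (\<forall>i\<le>Suc n. \<forall>x. \<bar>(deriv ^^ i) (\<lambda>x. \<epsilon> * scaled_bump n False x) x\<bar> \<le> (1/2) ^ Suc (Suc n) \<and>
      \<bar>(deriv ^^ i) (inverse_displacement (\<lambda>x. \<epsilon> * scaled_bump n False x)) x\<bar> \<le> (1/2) ^ Suc (Suc n))"
    using small_perturbation[OF smooth_scaled_bump p, of n False "Suc n"] by blast
  have m: "0 < min e1 e2 \<and> min e1 e2 \<le> e1" "0 < min e1 e2 \<and> min e1 e2 \<le> e2"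
    using e1(1) e2(1) by auto
  \<comment> \<open>The bounds persist for all smaller scales, so the minimum suits both
    digits.\<close>
  have "admissible_scale n (min e1 e2)"
    unfolding admissible_scale_def all_bool_eq
    using m(1) e1(2)[rule_format, OF m(1)] e2(2)[rule_format, OF m(2)] by blast
  then show ?thesis unfolding bump_scale_def by (rule someI)
qed

lemma bump_scale_pos: "bump_scale n > 0"
  using admissible_bump_scale by (simp add: admissible_scale_def)

lemma smooth_bump: "smooth_bounded (bump n i)"
  unfolding bump_def by (rule smooth_family_cmult[OF smooth_scaled_bump])

lemma periodic1_bump: "periodic1 (bump n i)"
  by (simp add: periodic1_def bump_def scaled_bump_def)

lemma bump_deriv_ge: "1/2 \<le> 1 + deriv (bump n i) x"
  using admissible_bump_scale unfolding admissible_scale_def bump_def by blast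

lemma bump_strict_mono: "strict_mono (\<lambda>x. x + bump n i x)"
  and bump_bij: "bij (\<lambda>x. x + bump n i x)"
  using strict_mono_perturbation(1,3)[OF smooth_bump _ bump_deriv_ge] by simp_all

lemma bump_zero: "frac x \<notin> {bump_start n<..<bump_start n + bump_length n i} \<Longrightarrow> bump n i x = 0"
  and bump_pos: "frac x \<in> {bump_start n<..<bump_start n + bump_length n i} \<Longrightarrow> bump n i x > 0"
  using scaled_bump_zero scaled_bump_pos bump_scale_pos by (auto simp: bump_def)

lemma bump_nonneg: "bump n i x \<ge> 0"
  using bump_zero bump_pos less_imp_le by (metis order_refl)

lemma bump_outside_block:
  assumes "x \<notin> block n"
  shows "bump n i x = 0"
proof (rule bump_zero)
  show "frac x \<notin> {bump_start n<..<bump_start n + bump_length n i}"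
    using assms bump_interval_bounds(1,2)[of n i] bump_length_pos[of n i] by (auto simp: block_def)
qed

lemma inverse_displacement_bump_outside_block:
  assumes "x \<notin> block n"
  shows "inverse_displacement (bump n i) x = 0"
  using perturbation_inverse(1)[OF bump_bij, of n i x] bump_outside_block[OF assms] by simp

text \<open>The map is injective and fixes every point outside the block, so no point of the block
  can be sent there.\<close>

lemma bump_preserves_block: "x + bump n i x \<in> block n \<longleftrightarrow> x \<in> block n"
proof (cases "x \<in> block n")
  case True
  have "x + bump n i x \<in> block n"
  proof (rule ccontr)
    assume "x + bump n i x \<notin> block n"
    then have "x + bump n i x + bump n i (x + bump n i x) = x + bump n i x"
      by (simp add: bump_outside_block)
    then have "x + bump n i x = x"
      using injD[OF bij_is_inj[OF bump_bij[of n i]], of "x + bump n i x" x] by simp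
    then show False using True \<open>x + bump n i x \<notin> block n\<close> by simp
  qed
  then show ?thesis using True by simp
qed (simp add: bump_outside_block)

section \<open>Superposition of all bumps\<close>

definition displacement :: "(nat \<Rightarrow> bool) \<Rightarrow> real \<Rightarrow> real" where
  "displacement a x = (\<Sum>n. bump n (a n) x)"

definition bump_diffeo :: "(nat \<Rightarrow> bool) \<Rightarrow> circle \<Rightarrow> circle" where
  "bump_diffeo a = circle_perturbation (displacement a)"

lemma small_bumps_bump: "small_bumps (\<lambda>n. bump n (a n))"
  using admissible_bump_scale smooth_bump
  unfolding small_bumps_def admissible_scale_def bump_def by blast

lemma small_bumps_inverse: "small_bumps (\<lambda>n. inverse_displacement (bump n (a n)))"
  using admissible_bump_scale smooth_perturbation_inverse[OF smooth_bump _ bump_deriv_ge]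
  unfolding small_bumps_def admissible_scale_def bump_def by auto

text \<open>First derivatives are in the controlled range for every \<open>n\<close>, and the bounds
  \<open>(1/2) ^ (n + 2)\<close> add up to 1/2.\<close>

lemma small_bumps_deriv_ge:
  assumes "small_bumps b"
  shows "1/2 \<le> 1 + deriv (\<lambda>x. \<Sum>n. b n x) x"
proof -
  have s: "(\<lambda>n. (1/2) * (1/2::real) ^ Suc n) sums ((1/2) * 1)"
    by (intro sums_mult power_half_series)
  have "\<bar>\<Sum>n. deriv (b n) x\<bar> \<le> (\<Sum>n. (1/2) * (1/2) ^ Suc n)"
    using norm_suminf_le[of "\<lambda>n. deriv (b n) x" "\<lambda>n. (1/2) * (1/2) ^ Suc n"] sums_summable[OF s]
      assms[unfolded small_bumps_def, THEN spec, THEN conjunct2, THEN spec[of _ 1]] by simp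
  also have "\<dots> = 1/2" using sums_unique[OF s] by simp
  finally show ?thesis using small_bumps_series(2)[OF assms, of 1 x] by simp
qed

lemma suminf_only:
  fixes f :: "nat \<Rightarrow> real"
  assumes "\<And>m. m \<noteq> n \<Longrightarrow> f m = 0"
  shows "suminf f = f n"
  using suminf_finite[of "{n}" f] assms by auto

lemma displacement_in_block:
  assumes "x \<in> block n"
  shows "displacement a x = bump n (a n) x"
  unfolding displacement_def
  by (rule suminf_only) (use assms block_disjoint bump_outside_block in blast)

lemma displacement_outside_blocks:
  assumes "\<And>n. x \<notin> block n"
  shows "displacement a x = 0"
  using assms by (simp add: displacement_def bump_outside_block)

lemma periodic1_displacement: "periodic1 (displacement a)"
  using periodic1_bump by (simp add: periodic1_def displacement_def)

lemma displacement_preserves_block: "x + displacement a x \<in> block n \<longleftrightarrow> x \<in> block n"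
proof (cases "\<exists>m. x \<in> block m")
  case True
  then obtain m where m: "x \<in> block m" by blast
  then have "x + displacement a x \<in> block m"
    by (simp add: displacement_in_block bump_preserves_block)
  then show ?thesis using m block_disjoint by blast
qed (simp add: displacement_outside_blocks)

lemma smooth_displacement: "smooth_bounded (displacement a)"
  using small_bumps_series(1)[OF small_bumps_bump] by (simp add: displacement_def[abs_def])

lemma displacement_deriv_ge: "1/2 \<le> 1 + deriv (displacement a) x"
  using small_bumps_deriv_ge[OF small_bumps_bump] by (simp add: displacement_def[abs_def])

text \<open>Each block is invariant and carries a single bump, so the inverse can be taken block by
  block. It is thus a series of small bumps too, and the metric, which also compares inverses, is
  estimated by the same lemmas.\<close>

lemma inverse_displacement_eq:
  "inverse_displacement (displacement a) = (\<lambda>x. \<Sum>n. inverse_displacement (bump n (a n)) x)"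
proof
  fix x
  define w where "w = (\<Sum>n. inverse_displacement (bump n (a n)) x)"
  have b: "bij (\<lambda>x. x + displacement a x)"
    using strict_mono_perturbation(3)[OF smooth_displacement _ displacement_deriv_ge] by simp
  have "x + w + displacement a (x + w) = x"
  proof (cases "\<exists>n. x \<in> block n")
    case True
    then obtain n where n: "x \<in> block n" by blast
    have "w = inverse_displacement (bump n (a n)) x"
      unfolding w_def
      by (rule suminf_only) (use n block_disjoint inverse_displacement_bump_outside_block in blast)
    then have xw: "x + w = perturbation_inverse (bump n (a n)) x" by simp
    have inv: "x + w + bump n (a n) (x + w) = x"
      unfolding xw by (rule perturbation_inverse(2)[OF bump_bij])
    then have "x + w \<in> block n" using n bump_preserves_block by metis
    then show ?thesis using inv by (simp add: displacement_in_block)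
  next
    case False
    then have "w = 0" by (simp add: w_def inverse_displacement_bump_outside_block)
    then show ?thesis using False by (simp add: displacement_outside_blocks)
  qed
  then have "perturbation_inverse (displacement a) x = x + w"
    using perturbation_inverse(1)[OF b, of "x + w"] by (simp only:)
  then show "inverse_displacement (displacement a) x = (\<Sum>n. inverse_displacement (bump n (a n)) x)"
    by (simp add: w_def)
qed

lemma bump_diffeo_smooth: "bump_diffeo a \<in> smooth_diffeos"
  unfolding bump_diffeo_def
  by (rule circle_perturbation_smooth_diffeo[OF smooth_displacement periodic1_displacement _ displacement_deriv_ge]) simp

lemma inv_bump_diffeo:
  "inv (bump_diffeo a) = circle_perturbation (\<lambda>x. \<Sum>n. inverse_displacement (bump n (a n)) x)"
  unfolding bump_diffeo_def inverse_displacement_eq[symmetric]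
  by (rule inv_circle_perturbation[OF smooth_displacement periodic1_displacement _ displacement_deriv_ge]) simp

text \<open>A modulus of continuity in the digits: the bump series agree in all terms below
  \<open>N\<close>, and so do those of the inverses.\<close>

lemma bump_diffeo_dist:
  assumes "\<And>n. n < N \<Longrightarrow> a n = b n"
  shows "smooth_dist (bump_diffeo a) (bump_diffeo b) \<le> 2 * (1/2) ^ N"
proof -
  have per: "periodic1 (\<lambda>x. \<Sum>n. inverse_displacement (bump n (c n)) x)" for c
    unfolding inverse_displacement_eq[symmetric]
    using periodic1_inverse_displacement[OF periodic1_displacement strict_mono_perturbation(3)[OF smooth_displacement _ displacement_deriv_ge]]
    by simp
  have "deriv_dist i (bump_diffeo a) (bump_diffeo b) \<le> (1/2) ^ N" if "i \<le> N" for i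
    unfolding bump_diffeo_def
    by (rule deriv_dist_circle_perturbation[OF smooth_displacement periodic1_displacement
          smooth_displacement periodic1_displacement])
      (use that assms in \<open>auto simp: displacement_def[abs_def]
         intro!: small_bumps_series_diff small_bumps_bump\<close>)
  moreover have "deriv_dist i (inv (bump_diffeo a)) (inv (bump_diffeo b)) \<le> (1/2) ^ N" if "i \<le> N" for i
    unfolding inv_bump_diffeo
    by (rule deriv_dist_circle_perturbation[OF small_bumps_series(1)[OF small_bumps_inverse] per
          small_bumps_series(1)[OF small_bumps_inverse] per])
      (use that assms in \<open>auto intro!: small_bumps_series_diff small_bumps_inverse\<close>)
  ultimately have "diffeo_dist k (bump_diffeo a) (bump_diffeo b) \<le> (1/2) ^ N" if "k \<le> N" for k
    using that unfolding diffeo_dist_def C_k_dist_def by auto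
  then show ?thesis using smooth_dist_le[OF bump_diffeo_smooth bump_diffeo_smooth, of N a b "(1/2) ^ N"] by simp
qed

section \<open>Regularity classes and flipping a digit\<close>

lemma to_circle_frac: "to_circle (frac x) = to_circle x"
  unfolding to_circle_eq_iff frac_def by simp

lemma circle_cases01:
  obtains x where "p = to_circle x" "0 \<le> x" "x < 1"
  using that[of "frac (rep_circle p)"] by (simp add: to_circle_frac frac_ge_0 frac_lt_1)

lemma block_iff01:
  assumes "0 \<le> x" "x < 1"
  shows "x \<in> block n \<longleftrightarrow> (1/2) ^ (n + 2) < x \<and> x < (1/2) ^ (n + 1)"
  using assms by (simp add: block_def frac_unique_iff[THEN iffD2])

text \<open>The conjugacy shrinks the longer arc affinely onto the shorter one and is supported in
  block \<open>n\<close>, where no other bump lives. As the two bumps are affine copies, it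
  intertwines the maps exactly.\<close>

lemma bump_diffeo_flip:
  "\<exists>h\<in>smooth_diffeos. bump_diffeo (a(n := True)) = h \<circ> bump_diffeo (a(n := False)) \<circ> inv h"
proof -
  define c where "c = bump_start n"
  define r where "r = bump_length n False"
  define s where "s = bump_length n True"
  define \<mu> where "\<mu> = s / r"
  have r: "r > 0" and s: "s > 0" "s \<le> r"
    using bump_length_pos bump_length_mono[of n False n True] by (auto simp: r_def s_def)
  have \<mu>: "0 < \<mu>" "\<mu> \<le> 1" "\<mu> * r = s" using r s by (auto simp: \<mu>_def)
  have c: "(1/2) ^ (n + 2) \<le> c - r" "c + 2 * r < (1/2) ^ (n + 1)" "(1/2::real) ^ (n + 1) \<le> 1/2"
    unfolding c_def r_def by (rule bump_interval_bounds)+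
  have p2: "(1/2::real) ^ (n + 2) > 0" by simp
  obtain \<psi> where \<psi>: "smooth_bounded \<psi>" "\<And>x. frac x \<notin> {c - r<..<c + 2 * r} \<Longrightarrow> \<psi> x = 0"
    "\<And>x. \<psi> (frac x) = \<psi> x" "\<And>x. \<mu> \<le> 1 + deriv \<psi> x"
    "\<And>x. frac x \<in> {c..c + r} \<Longrightarrow> \<psi> x = (\<mu> - 1) * (frac x - c)"
    by (rule affine_contraction[of r \<mu> c]) (use r \<mu> c p2 in auto)
  have per: "periodic1 \<psi>" using \<psi>(3) by (simp add: periodic1_def)
  have frac01: "frac x = x" if "0 \<le> x" "x < 1" for x :: real
    using that by (simp add: frac_unique_iff[THEN iffD2])
  have mono\<psi>: "x < y \<longleftrightarrow> x + \<psi> x < y + \<psi> y" for x y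
    using strict_mono_less[OF strict_mono_perturbation(1)[OF \<psi>(1) \<mu>(1) \<psi>(4)]] by simp
  have monob: "x < y \<longleftrightarrow> x + bump n i x < y + bump n i y" for x y i
    using strict_mono_less[OF bump_strict_mono] by simp
  define h where "h = circle_perturbation \<psi>"
  have h: "h \<in> smooth_diffeos"
    unfolding h_def by (rule circle_perturbation_smooth_diffeo[OF \<psi>(1) per \<mu>(1) \<psi>(4)])
  \<comment> \<open>The conjugacy equation for lifts, valid between reals and not merely modulo
    1.\<close>
  have key: "x + \<psi> x + displacement (a(n := True)) (x + \<psi> x) =
      (x + displacement (a(n := False)) x) + \<psi> (x + displacement (a(n := False)) x)"
    if x: "0 \<le> x" "x < 1" for x
  proof (cases "x \<in> block n")
    case True
    have J: "(1/2) ^ (n + 2) < x" "x < (1/2) ^ (n + 1)" using True block_iff01[OF x] by auto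
    define y where "y = x + bump n False x"
    define z where "z = x + \<psi> x"
    have e: "frac ((1/2::real) ^ (n + 2)) = (1/2) ^ (n + 2)" "frac ((1/2::real) ^ (n + 1)) = (1/2) ^ (n + 1)"
      using c r by (auto intro!: frac01)
    \<comment> \<open>Both end points of the block are fixed by the contraction, so monotonicity
      keeps \<open>z\<close> between them.\<close>
    have "\<psi> ((1/2) ^ (n + 2)) = 0" "\<psi> ((1/2) ^ (n + 1)) = 0"
      using c r by (auto intro!: \<psi>(2) simp: e)
    then have z: "(1/2) ^ (n + 2) < z" "z < (1/2) ^ (n + 1)"
      using mono\<psi>[of "(1/2) ^ (n + 2)" x] mono\<psi>[of x "(1/2) ^ (n + 1)"] J by (auto simp: z_def)
    then have zb: "0 \<le> z" "z < 1" using p2 c by linarith+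
    then have zblock: "z \<in> block n" using z block_iff01 by blast
    have "displacement (a(n := True)) z = bump n True z" "displacement (a(n := False)) x = bump n False x"
      using displacement_in_block[OF zblock] displacement_in_block[OF True] by auto
    moreover have "z + bump n True z = y + \<psi> y"
    proof (cases "x \<in> {c..c + r}")
      case in_bump: True
      have cr: "0 < c" "c + r < 1" using c r p2 by linarith+
      \<comment> \<open>The right end of the arc is a fixed point, so \<open>y\<close> cannot pass
        it and \<open>\<psi>\<close> is still linear at \<open>y\<close>.\<close>
      have "bump n False (c + r) = 0"
        using cr r by (intro bump_zero) (simp add: frac01 c_def[symmetric] r_def[symmetric])
      then have y: "y \<in> {c..c + r}"
        using monob[of x "c + r" False] in_bump bump_nonneg[of n False x]
        by (cases "x = c + r") (auto simp: y_def)
      have fx: "frac x = x" "frac y = y" "frac z = z"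
        using frac01 x y zb cr by auto
      have z_eq: "z = c + \<mu> * (x - c)" using \<psi>(5)[of x] in_bump fx by (simp add: z_def algebra_simps)
      have "(z - c) / s = (x - c) / r" using z_eq r s by (simp add: \<mu>_def)
      then have "bump n True z = \<mu> * bump n False x"
        using \<mu>(3) fx by (simp add: bump_def scaled_bump_def flip: c_def r_def s_def)
      then have "z + bump n True z = c + \<mu> * (y - c)" by (simp add: z_eq y_def algebra_simps)
      also have "\<dots> = y + \<psi> y" using \<psi>(5)[of y] y fx by (simp add: algebra_simps)
      finally show ?thesis .
    next
      case False
      have fx: "frac x = x" "frac z = z" using frac01 x zb by auto
      have "bump n False x = 0"
        by (rule bump_zero) (use False fx in \<open>auto simp: c_def r_def\<close>)
      moreover have "frac (c + r) = c + r" "frac c = c" using frac01 c r p2 by auto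
      \<comment> \<open>The contraction fixes \<open>c\<close> and takes \<open>c + r\<close> to
        \<open>c + s\<close>, hence sends points off the long arc to points off the short one, where
        both bumps vanish.\<close>
      then have "\<psi> (c + r) = (\<mu> - 1) * r" "\<psi> c = 0" using \<psi>(5)[of "c + r"] \<psi>(5)[of c] r by auto
      then have "z \<notin> {c<..<c + s}"
        using mono\<psi>[of x c] mono\<psi>[of "c + r" x] False \<mu>(3) by (auto simp: z_def algebra_simps)
      then have "bump n True z = 0"
        by (intro bump_zero) (use fx in \<open>auto simp: c_def s_def\<close>)
      ultimately show ?thesis by (simp add: y_def z_def)
    qed
    ultimately show ?thesis by (simp add: y_def z_def)
  next
    case False
    have \<psi>0: "\<psi> w = 0" if "w \<notin> block n" for w
      using that c by (intro \<psi>(2)) (auto simp: block_def)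
    have "displacement (a(n := True)) x = displacement (a(n := False)) x"
      unfolding displacement_def by (rule suminf_cong) (simp add: bump_outside_block[OF False])
    moreover have "x + displacement (a(n := False)) x \<notin> block n"
      using False displacement_preserves_block by blast
    ultimately show ?thesis using \<psi>0 False by simp
  qed
  have comm: "bump_diffeo (a(n := True)) (h p) = h (bump_diffeo (a(n := False)) p)" for p
  proof -
    obtain x where x: "p = to_circle x" "0 \<le> x" "x < 1" by (rule circle_cases01)
    show ?thesis
      unfolding bump_diffeo_def h_def x(1)
      by (simp add: circle_perturbation_to_circle per periodic1_displacement key[OF x(2,3)])
  qed
  have "surj h" using smooth_diffeosD(3)[OF h] by (simp add: bij_def)
  have "bump_diffeo (a(n := True)) = h \<circ> bump_diffeo (a(n := False)) \<circ> inv h"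
  proof
    fix p
    show "bump_diffeo (a(n := True)) p = (h \<circ> bump_diffeo (a(n := False)) \<circ> inv h) p"
      using comm[of "inv h p"] surj_f_inv_f[OF \<open>surj h\<close>] by simp
  qed
  then show ?thesis using h by blast
qed

section \<open>Inclusions between the regularity classes\<close>

lemma circle_near_representatives:
  obtains x y where "p = to_circle x" "q = to_circle y" "dist p q = \<bar>x - y\<bar>"
proof -
  define n where "n = round (rep_circle p - rep_circle q)"
  have "to_circle (rep_circle p - n) = p"
    using to_circle_eq_iff[of "rep_circle p - n" "rep_circle p"] by simp
  then show ?thesis
    using that[of "rep_circle p - n" "rep_circle q"] dist_to_circle[of "rep_circle p" "rep_circle q"]
    by (simp add: n_def algebra_simps)
qed

text \<open>Distances on the circle are at most 1, and there lowering the exponent does not decrease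
  a power.\<close>

lemma lipschitz_imp_hoelder_on_circle:
  assumes "\<And>p q. dist (u p) (u q) \<le> C * dist p q" "0 < \<beta>" "\<beta> < 1"
  shows "hoelder_on_circle \<beta> u"
  unfolding hoelder_on_circle_def
proof (intro exI[of _ "\<bar>C\<bar>"] allI)
  fix p q :: circle
  have "dist p q \<le> 1" using dist_circle_le_half[of p q] by simp
  then have "dist p q powr 1 \<le> dist p q powr \<beta>" using assms by (intro powr_mono') auto
  then have "\<bar>C\<bar> * dist p q \<le> \<bar>C\<bar> * dist p q powr \<beta>" by (intro mult_left_mono) auto
  moreover have "C * dist p q \<le> \<bar>C\<bar> * dist p q" by (intro mult_right_mono) auto
  ultimately show "dist (u p) (u q) \<le> \<bar>C\<bar> * dist p q powr \<beta>" using assms(1)[of p q] by linarith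
qed

lemma DERIV_bounded_lipschitz:
  fixes g g' :: "real \<Rightarrow> real"
  assumes "\<And>x. (g has_real_derivative g' x) (at x)" "\<And>x. \<bar>g' x\<bar> \<le> B"
  shows "\<bar>g x - g y\<bar> \<le> B * \<bar>x - y\<bar>"
  using field_differentiable_bound[of UNIV g g' B y x] assms by (simp add: abs_minus_commute)

text \<open>The derivative of order \<open>k + 1\<close> descends to the circle, where compactness
  bounds it.\<close>

lemma higher_deriv_lift_lipschitz:
  assumes "is_lift F f" "C_k_real (Suc k) F"
  obtains B where "\<And>x y. \<bar>(deriv ^^ k) F x - (deriv ^^ k) F y\<bar> \<le> B * \<bar>x - y\<bar>"
proof -
  have "C_k_circle (Suc k) f" using assms by (auto simp: C_k_circle_def)
  then obtain B where B: "\<And>p. \<bar>circle_deriv (Suc k) f p\<bar> \<le> B"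
    using bounded_circle_deriv[of "Suc k" f] by (auto simp: bounded_iff)
  have "\<bar>(deriv ^^ Suc k) F x\<bar> \<le> B" for x
    using B[of "to_circle x"] circle_deriv_eq[OF assms(1), of "Suc k" x] by simp
  moreover have "((deriv ^^ k) F has_real_derivative (deriv ^^ Suc k) F x) (at x)" for x
    using assms(2) DERIV_deriv_iff_real_differentiable by (auto simp: C_k_real_def)
  ultimately show ?thesis using that DERIV_bounded_lipschitz by blast
qed

lemma C_1_circle_hoelder:
  assumes "C_k_circle 1 f" "0 < \<beta>" "\<beta> < 1"
  shows "hoelder_on_circle \<beta> f"
proof -
  obtain F where F: "is_lift F f" "C_k_real (Suc 0) F" using assms(1) by (auto simp: C_k_circle_def)
  obtain B where B: "\<And>x y. \<bar>F x - F y\<bar> \<le> B * \<bar>x - y\<bar>"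
    using higher_deriv_lift_lipschitz[OF F] by auto
  have "dist (f p) (f q) \<le> B * dist p q" for p q
  proof -
    obtain x y where xy: "p = to_circle x" "q = to_circle y" "dist p q = \<bar>x - y\<bar>"
      by (rule circle_near_representatives)
    have "dist (f p) (f q) \<le> \<bar>F x - F y\<bar>"
      using dist_to_circle_le[of "F x" "F y"] F(1) by (simp add: is_lift_def xy(1,2) dist_real_def)
    then show ?thesis using B[of x y] xy(3) by simp
  qed
  then show ?thesis by (rule lipschitz_imp_hoelder_on_circle[OF _ assms(2,3)])
qed

lemma C_Suc_circle_hoelder_deriv:
  assumes "C_k_circle (Suc k) f" "k \<ge> 1" "0 < \<beta>" "\<beta> < 1"
  shows "hoelder_on_circle \<beta> (circle_deriv k f)"
proof -
  obtain F where F: "is_lift F f" "C_k_real (Suc k) F" using assms(1) by (auto simp: C_k_circle_def)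
  obtain B where B: "\<And>x y. \<bar>(deriv ^^ k) F x - (deriv ^^ k) F y\<bar> \<le> B * \<bar>x - y\<bar>"
    using higher_deriv_lift_lipschitz[OF F] by auto
  have "dist (circle_deriv k f p) (circle_deriv k f q) \<le> B * dist p q" for p q
  proof -
    obtain x y where xy: "p = to_circle x" "q = to_circle y" "dist p q = \<bar>x - y\<bar>"
      by (rule circle_near_representatives)
    show ?thesis
      unfolding xy(3) using B[of x y]
      by (simp add: xy(1,2) dist_real_def circle_deriv_eq[OF F(1) assms(2)])
  qed
  then show ?thesis by (rule lipschitz_imp_hoelder_on_circle[OF _ assms(3,4)])
qed

text \<open>Makes the conjugacies for digit flips available in every class.\<close>

lemma smooth_diffeos_subset_regularity_class:
  assumes "D \<in> regularity_classes"
  shows "smooth_diffeos \<subseteq> D"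
proof
  fix f assume f: "f \<in> smooth_diffeos"
  have k: "f \<in> circle_diffeos k" for k using f by (auto simp: smooth_diffeos_def)
  have "f \<in> hoelder_diffeos k \<beta>" if "0 < \<beta>" "\<beta> < 1" for k \<beta>
    using k[of k] C_1_circle_hoelder[OF smooth_diffeosD(1)[OF f] that]
      C_Suc_circle_hoelder_deriv[OF smooth_diffeosD(1)[OF f] _ that, of k]
    by (auto simp: hoelder_diffeos_def circle_diffeos_def)
  moreover have "\<exists>\<beta>::real. 0 < \<beta> \<and> \<beta> < 1" by (rule exI[of _ "1/2"]) simp
  ultimately show "f \<in> D"
    using assms f k by (auto simp: regularity_classes_def)
qed

lemma circle_diffeo_hoelder:
  assumes "f \<in> circle_diffeos k" "k \<ge> 1" "0 < \<beta>" "\<beta> < 1"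
  shows "hoelder_on_circle \<beta> f"
proof -
  obtain F where F: "is_lift F f" "C_k_real k F"
    using assms(1) by (auto simp: circle_diffeos_def C_k_circle_def)
  have "continuous_on UNIV (deriv F)"
  proof (cases "k = 1")
    case False
    then have "1 < k" using assms(2) by simp
    then have "\<forall>x. (deriv ^^ 1) F differentiable (at x)" using F(2) unfolding C_k_real_def by blast
    then show ?thesis
      by (auto intro!: continuous_at_imp_continuous_on differentiable_imp_continuous_within)
  qed (use F(2) in \<open>auto simp: C_k_real_def\<close>)
  moreover have "F differentiable (at x)" for x
    using F(2) assms(2) unfolding C_k_real_def by (metis funpow_0 less_le_trans zero_less_one)
  ultimately have "C_k_circle 1 f" using F(1) by (auto simp: C_k_circle_def C_k_real_def)
  then show ?thesis by (rule C_1_circle_hoelder[OF _ assms(3,4)])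
qed

text \<open>The weak consequence common to all classes, from which conjugacies are excluded. The
  exponent may depend on \<open>h\<close>.\<close>

lemma regularity_class_hoelder:
  assumes "D \<in> regularity_classes" "h \<in> D"
  obtains \<beta> where "0 < \<beta>" "hoelder_on_circle \<beta> h" "h \<in> circle_homeos"
proof -
  have diffeo: "\<exists>\<beta>>0. hoelder_on_circle \<beta> h \<and> h \<in> circle_homeos" if "h \<in> circle_diffeos k" "k \<ge> 1" for k
    using circle_diffeo_hoelder[OF that, of "1/2"] that(1)
    by (intro exI[of _ "1/2"]) (auto simp: circle_diffeos_def)
  have hoelder: "\<exists>\<beta>>0. hoelder_on_circle \<beta> h \<and> h \<in> circle_homeos"
    if "h \<in> hoelder_diffeos k \<beta>" "0 < \<beta>" for k \<beta>
    using that diffeo[of k] by (auto simp: hoelder_diffeos_def split: if_splits)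
  have "smooth_diffeos \<subseteq> circle_diffeos 1" by (auto simp: smooth_diffeos_def)
  then have "\<exists>\<beta>>0. hoelder_on_circle \<beta> h \<and> h \<in> circle_homeos"
    using assms diffeo[of 1] by (auto simp: regularity_classes_def intro: hoelder diffeo)
  then show ?thesis using that by blast
qed

section \<open>Hoelder conjugacies\<close>

definition arc :: "nat \<Rightarrow> bool \<Rightarrow> circle set" where
  "arc n i = to_circle ` {bump_start n<..<bump_start n + bump_length n i}"

lemma bump_interval_in_unit: "0 < bump_start n" "bump_start n + bump_length n i < 1/2"
  using bump_start_pos bump_length_pos[of n i] bump_interval_bounds(2)[of n i] bump_interval_bounds(3)[of n]
  by (auto intro: order.strict_trans2)

lemma to_circle_inj01: "to_circle x = to_circle y \<Longrightarrow> 0 \<le> x \<Longrightarrow> x < 1 \<Longrightarrow> 0 \<le> y \<Longrightarrow> y < 1 \<Longrightarrow> x = y"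
  using Ints_nonzero_abs_less1[of "x - y"] by (simp add: to_circle_eq_iff)

lemma open_to_circle_image:
  assumes "open A"
  shows "open (to_circle ` A)"
proof -
  have "to_circle -` to_circle ` A = (\<Union>n::int. (\<lambda>x. x + of_int n) ` A)"
  proof (intro set_eqI iffI)
    fix x assume "x \<in> to_circle -` to_circle ` A"
    then obtain y n where "y \<in> A" "x - y = of_int n" by (auto simp: to_circle_eq_iff elim!: Ints_cases)
    then have "y \<in> A" "x = y + of_int n" by auto
    then show "x \<in> (\<Union>n::int. (\<lambda>x. x + of_int n) ` A)" by blast
  next
    fix x assume "x \<in> (\<Union>n::int. (\<lambda>x. x + of_int n) ` A)"
    then obtain y n where y: "y \<in> A" "x = y + of_int n" by blast
    then have "to_circle x = to_circle y" by (simp add: to_circle_eq_iff)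
    then show "x \<in> to_circle -` to_circle ` A" using y(1) by auto
  qed
  moreover have "open ((\<lambda>x. x + of_int n) ` A)" for n :: int
    using open_translation[OF assms, of "of_int n"] by (simp add: add.commute)
  ultimately show ?thesis by (auto simp: open_circle_iff)
qed

lemma open_arc: "open (arc n i)"
  unfolding arc_def by (intro open_to_circle_image) auto

lemma connected_arc: "connected (arc n i)"
  unfolding arc_def by (intro connected_continuous_image continuous_to_circle) auto

lemma to_circle_in_arc:
  assumes "0 \<le> x" "x < 1"
  shows "to_circle x \<in> arc n i \<longleftrightarrow> x \<in> {bump_start n<..<bump_start n + bump_length n i}"
proof
  assume "to_circle x \<in> arc n i"
  then obtain y where y: "to_circle x = to_circle y" "y \<in> {bump_start n<..<bump_start n + bump_length n i}"
    by (auto simp: arc_def)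
  then have "x = y" using assms bump_interval_in_unit(1)[of n] bump_interval_in_unit(2)[of n i]
    by (intro to_circle_inj01) auto
  then show "x \<in> {bump_start n<..<bump_start n + bump_length n i}" using y by simp
qed (auto simp: arc_def)

lemma arc_in_block:
  assumes "0 \<le> x" "x < 1" "to_circle x \<in> arc n i"
  shows "x \<in> block n"
proof -
  have "bump_start n < x" "x < bump_start n + bump_length n i"
    using assms(3) unfolding to_circle_in_arc[OF assms(1,2)] by auto
  then show ?thesis
    unfolding block_iff01[OF assms(1,2)]
    using bump_interval_bounds(1,2)[of n i] bump_length_pos[of n i] by linarith
qed

lemma arc_disjoint:
  assumes "p \<in> arc n i" "p \<in> arc m j"
  shows "n = m"
proof -
  obtain x where x: "p = to_circle x" "0 \<le> x" "x < 1" by (rule circle_cases01)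
  show ?thesis using assms block_disjoint arc_in_block[OF x(2,3)] unfolding x(1) by blast
qed

lemma bump_diffeo_moves: "bump_diffeo a p \<noteq> p \<longleftrightarrow> (\<exists>n. p \<in> arc n (a n))"
proof -
  obtain x where x: "p = to_circle x" "0 \<le> x" "x < 1" by (rule circle_cases01)
  have fx: "frac x = x" using x by (simp add: frac_unique_iff[THEN iffD2])
  \<comment> \<open>A displacement in \<open>[0, 1)\<close> is an integer only if it vanishes, so
    fixed points on the circle are exactly zeros of the displacement.\<close>
  have b: "0 \<le> bump n i x" "bump n i x < 1" for n i
  proof -
    have "\<bar>(deriv ^^ 0) (bump n i) x\<bar> \<le> (1/2) ^ Suc (Suc n)"
      using admissible_bump_scale[of n] unfolding admissible_scale_def bump_def by blast
    also have "\<dots> < 1" using power_le_one[of "1/2::real" n] by simp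
    finally show "bump n i x < 1" by simp
  qed (rule bump_nonneg)
  have moves: "bump_diffeo a p \<noteq> p \<longleftrightarrow> displacement a x \<notin> \<int>"
    unfolding x(1) bump_diffeo_def circle_perturbation_to_circle[OF periodic1_displacement]
    by (simp add: to_circle_eq_iff)
  show ?thesis
  proof (cases "\<exists>n. x \<in> block n")
    case True
    then obtain n where n: "x \<in> block n" by blast
    have "bump_diffeo a p \<noteq> p \<longleftrightarrow> bump n (a n) x \<noteq> 0"
      unfolding moves displacement_in_block[OF n] using b Ints_nonzero_abs_less1[of "bump n (a n) x"] by auto
    also have "\<dots> \<longleftrightarrow> p \<in> arc n (a n)"
      unfolding x(1) to_circle_in_arc[OF x(2,3)] using bump_zero[of x n "a n"] bump_pos[of x n "a n"] fx by auto
    also have "\<dots> \<longleftrightarrow> (\<exists>m. p \<in> arc m (a m))"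
    proof
      assume "\<exists>m. p \<in> arc m (a m)"
      then obtain m where m: "p \<in> arc m (a m)" by blast
      then have "x \<in> block m" using arc_in_block[OF x(2,3)] unfolding x(1) by blast
      then show "p \<in> arc n (a n)" using m n block_disjoint by blast
    qed blast
    finally show ?thesis .
  next
    case False
    then have "p \<notin> arc m (a m)" for m using arc_in_block[OF x(2,3)] unfolding x(1) by blast
    then show ?thesis using False by (simp add: moves displacement_outside_blocks)
  qed
qed

lemma dist_in_arc:
  assumes "p \<in> arc n i" "q \<in> arc n i"
  shows "dist p q \<le> bump_length n i"
proof -
  obtain x y where "p = to_circle x" "q = to_circle y"
    "x \<in> {bump_start n<..<bump_start n + bump_length n i}"
    "y \<in> {bump_start n<..<bump_start n + bump_length n i}"
    using assms by (auto simp: arc_def)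
  then show ?thesis using dist_to_circle_le[of x y] by (auto simp: dist_real_def)
qed

text \<open>An open arc does not attain its length; the points at one and three quarters realise
  half of it, and the lost factor 2 is absorbed later.\<close>

lemma arc_wide:
  obtains p q where "p \<in> arc n i" "q \<in> arc n i" "dist p q = bump_length n i / 2"
proof -
  define l where "l = bump_length n i"
  have l: "0 < l" "l < 1/2"
    using bump_length_pos[of n i] bump_interval_in_unit(1)[of n] bump_interval_in_unit(2)[of n i]
    unfolding l_def by linarith+
  define x where "x = bump_start n + l / 4"
  define y where "y = bump_start n + 3 * l / 4"
  have "round (y - x) = 0" using l by (intro round_unique) (auto simp: x_def y_def)
  then have "dist (to_circle y) (to_circle x) = l / 2"
    using l by (simp add: dist_to_circle) (simp add: x_def y_def)
  moreover have "to_circle x \<in> arc n i" "to_circle y \<in> arc n i"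
    using l(1) by (auto simp: arc_def x_def y_def l_def[symmetric] intro!: imageI)
  ultimately show ?thesis using that by (simp add: l_def)
qed

text \<open>
  A conjugacy permutes the moved arcs. Comparing the numbers of arcs of length at least
  that of arc \<open>N\<close> forces it to map some arc of length at most \<open>bump_length N True\<close> onto one
  of length at least \<open>bump_length N False\<close>.
\<close>

lemma conjugacy_expands_arc:
  assumes "h \<in> circle_homeos" "bump_diffeo a = h \<circ> bump_diffeo b \<circ> inv h" "\<not> a N" "b N"
  obtains p q where "dist p q \<le> bump_length N True" "bump_length N False / 2 \<le> dist (h p) (h q)"
proof -
  obtain g where g: "homeomorphism UNIV UNIV h g" using assms(1) by (auto simp: circle_homeos_def)
  then have cont: "continuous_on UNIV h" "continuous_on UNIV g" and hg: "h (g p) = p" and gh: "g (h p) = p" for p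
    by (auto simp: homeomorphism_def)
  have inv: "inv h = g" using hg gh by (intro inv_equality) auto
  have conj: "bump_diffeo a (h p) = h (bump_diffeo b p)" for p
    unfolding assms(2) inv by (simp add: gh)
  have moved: "(\<exists>n. h p \<in> arc n (a n)) \<longleftrightarrow> (\<exists>n. p \<in> arc n (b n))" for p
    unfolding bump_diffeo_moves[symmetric] conj using gh by metis
  \<comment> \<open>The target arcs are disjoint open sets covering the image of a connected arc, so
    the image stays in one of them.\<close>
  have inside: "\<exists>n. f ` arc m (c m) \<subseteq> arc n (d n)"
    if f: "continuous_on UNIV f" "\<And>p. p \<in> arc m (c m) \<Longrightarrow> \<exists>n. f p \<in> arc n (d n)"
    for f m and c d :: "nat \<Rightarrow> bool"
  proof -
    have conn: "connected (f ` arc m (c m))"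
      using connected_arc f(1) by (intro connected_continuous_image) (auto intro: continuous_on_subset)
    obtain p where p: "p \<in> arc m (c m)" using arc_wide by blast
    then obtain n where n: "f p \<in> arc n (d n)" using f(2) by blast
    define B where "B = (\<Union>k\<in>-{n}. arc k (d k))"
    have cover: "f ` arc m (c m) \<subseteq> arc n (d n) \<union> B"
    proof
      fix q assume "q \<in> f ` arc m (c m)"
      then obtain k where "q \<in> arc k (d k)" using f(2) by auto
      then show "q \<in> arc n (d n) \<union> B" by (cases "k = n") (auto simp: B_def)
    qed
    have "arc n (d n) \<inter> B = {}" unfolding B_def using arc_disjoint by fastforce
    then have "arc n (d n) \<inter> B \<inter> f ` arc m (c m) = {}" by simp
    moreover have "open B" unfolding B_def by (auto intro: open_arc)
    ultimately have "arc n (d n) \<inter> f ` arc m (c m) = {} \<or> B \<inter> f ` arc m (c m) = {}"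
      using connectedD[OF conn open_arc _ _ cover] by blast
    then have "B \<inter> f ` arc m (c m) = {}" using p n by blast
    then have "f ` arc m (c m) \<subseteq> arc n (d n)" using cover by blast
    then show ?thesis by blast
  qed
  have "\<exists>n. g ` arc m (a m) \<subseteq> arc n (b n)" for m
  proof (rule inside[OF cont(2)])
    fix p assume "p \<in> arc m (a m)"
    then show "\<exists>n. g p \<in> arc n (b n)" using moved[of "g p"] hg by auto
  qed
  then obtain \<sigma> where \<sigma>: "\<And>m. g ` arc m (a m) \<subseteq> arc (\<sigma> m) (b (\<sigma> m))" by metis
  have "\<exists>n. h ` arc m (b m) \<subseteq> arc n (a n)" for m
  proof (rule inside[OF cont(1)])
    fix p assume "p \<in> arc m (b m)"
    then show "\<exists>n. h p \<in> arc n (a n)" using moved[of p] by auto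
  qed
  then obtain \<tau> where \<tau>: "\<And>m. h ` arc m (b m) \<subseteq> arc (\<tau> m) (a (\<tau> m))" by metis
  \<comment> \<open>A point of arc \<open>m\<close> sent by \<open>g\<close> and back by
    \<open>h\<close> returns to arc \<open>m\<close>; so \<open>\<sigma>\<close> is
    injective.\<close>
  have "\<tau> (\<sigma> m) = m" for m
  proof -
    obtain p where p: "p \<in> arc m (a m)" using arc_wide by blast
    then have "h (g p) \<in> arc (\<tau> (\<sigma> m)) (a (\<tau> (\<sigma> m)))" using \<sigma> \<tau> by blast
    then show ?thesis using p hg arc_disjoint by metis
  qed
  then have inj: "inj_on \<sigma> {..N}" by (metis inj_onI)
  \<comment> \<open>Pigeonhole: \<open>N + 1\<close> indices do not fit injectively below
    \<open>N\<close>.\<close>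
  have "\<not> \<sigma> ` {..N} \<subseteq> {..<N}"
  proof
    assume "\<sigma> ` {..N} \<subseteq> {..<N}"
    then have "card (\<sigma> ` {..N}) \<le> card {..<N}" by (intro card_mono) auto
    then show False using card_image[OF inj] by simp
  qed
  then obtain m where m: "m \<le> N" "N \<le> \<sigma> m" by (metis atMost_iff image_subsetI lessThan_iff not_le)
  obtain p q where pq: "p \<in> arc m (a m)" "q \<in> arc m (a m)" "dist p q = bump_length m (a m) / 2"
    by (rule arc_wide)
  \<comment> \<open>For \<open>m = N\<close> this rests on the digit \<open>a N\<close>, otherwise
    on rank alone. The bound for \<open>\<sigma> m\<close> uses \<open>b N\<close> in the same
    way.\<close>
  have "bump_length N False \<le> bump_length m (a m)"
    using m(1) assms(3) by (intro bump_length_mono) (cases "m = N"; auto)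
  then have "bump_length N False / 2 \<le> dist (h (g p)) (h (g q))" using pq(3) hg by simp
  moreover have "dist (g p) (g q) \<le> bump_length (\<sigma> m) (b (\<sigma> m))"
    using pq \<sigma> by (intro dist_in_arc) blast+
  moreover have "bump_length (\<sigma> m) (b (\<sigma> m)) \<le> bump_length N True"
    using m(2) assms(4) by (intro bump_length_mono) (cases "\<sigma> m = N"; auto)
  ultimately show ?thesis using that[of "g p" "g q"] by linarith
qed

lemma bump_length_True: "bump_length N True = bump_length N False ^ (2 * N + 5)"
proof -
  have "fact (2 * N + 5) = (2 * N + 5) * (fact (2 * N + 4) :: nat)"
    using fact_Suc[of "2 * N + 4", where 'a = nat] by (simp add: add.commute)
  moreover have "2 * N + of_bool True + 4 = 2 * N + (5::nat)" "2 * N + of_bool False + 4 = 2 * N + (4::nat)"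
    by simp_all
  ultimately show ?thesis
    unfolding bump_length_def by (simp only: power_mult[symmetric] mult.commute[of "2 * N + 5"])
qed

text \<open>With \<open>l = bump_length N False\<close>, stretching gives
  \<open>l / 2 \<le> C * l powr ((2 * N + 5) * \<beta>)\<close>. Once the exponent is at least 2,
  this forces \<open>1/2 \<le> C * l\<close>, which fails for small \<open>l\<close>.\<close>

lemma hoelder_conjugacy_bounded:
  assumes "h \<in> circle_homeos" "bump_diffeo a = h \<circ> bump_diffeo b \<circ> inv h"
    "0 < \<beta>" "hoelder_on_circle \<beta> h"
  shows "\<exists>M. \<forall>N\<ge>M. \<not> (\<not> a N \<and> b N)"
proof -
  obtain C0 where C0: "\<And>p q. dist (h p) (h q) \<le> C0 * dist p q powr \<beta>"
    using assms(4) by (auto simp: hoelder_on_circle_def)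
  define C where "C = max C0 1"
  have C: "C \<ge> 1" "dist (h p) (h q) \<le> C * dist p q powr \<beta>" for p q
    using C0[of p q] mult_right_mono[of C0 C "dist p q powr \<beta>"] by (auto simp: C_def)
  \<comment> \<open>\<open>M1\<close> will push the exponent up to 2, and \<open>M2\<close> makes
    the arc too short for the constant \<open>C\<close>.\<close>
  obtain M1 :: nat where M1: "2 / \<beta> \<le> M1" using real_arch_simple by blast
  obtain M2 where M2: "(1/2::real) ^ M2 < 1 / (2 * C)"
    using real_arch_pow_inv[of "1 / (2 * C)" "1/2"] C(1) by auto
  have False if N: "M1 + M2 \<le> N" "\<not> a N" "b N" for N
  proof -
    define l where "l = bump_length N False"
    have l: "0 < l" "l \<le> (1/2) ^ (N + 4)" using bump_length_pos bump_length_le by (auto simp: l_def)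
    then have l1: "l \<le> 1" using power_le_one[of "1/2::real" "N + 4"] by linarith
    obtain p q where pq: "dist p q \<le> bump_length N True" "bump_length N False / 2 \<le> dist (h p) (h q)"
      by (rule conjugacy_expands_arc[OF assms(1,2) N(2,3)])
    have "2 \<le> \<beta> * M1" using M1 assms(3) by (simp add: field_simps)
    also have "\<dots> \<le> \<beta> * (2 * N + 5)" using N(1) assms(3) by (intro mult_left_mono) auto
    finally have e: "2 \<le> (2 * N + 5) * \<beta>" by (simp add: mult.commute)
    have "l / 2 \<le> C * dist p q powr \<beta>" using pq(2) C(2)[of p q] by (simp add: l_def)
    also have "\<dots> \<le> C * (l ^ (2 * N + 5)) powr \<beta>"
      using pq(1) C(1) assms(3) by (intro mult_left_mono powr_mono2) (auto simp: bump_length_True l_def)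
    also have "(l ^ (2 * N + 5)) powr \<beta> = l powr ((2 * N + 5) * \<beta>)"
      using l(1) by (simp add: powr_realpow[symmetric] powr_powr)
    also have "C * l powr ((2 * N + 5) * \<beta>) \<le> C * l powr 2"
      using e l(1) l1 C(1) by (intro mult_left_mono powr_mono') auto
    also have "\<dots> = C * l * l" using l(1) by (simp add: power2_eq_square)
    finally have "1/2 \<le> C * l" using l(1) by simp
    moreover have "(1/2::real) ^ (N + 4) \<le> (1/2) ^ M2" using N(1) by (intro power_decreasing) auto
    then have "l \<le> (1/2) ^ M2" using l(2) by linarith
    then have "l < 1 / (2 * C)" using M2 by linarith
    then have "C * l < 1/2" using C(1) by (simp add: field_simps)
    ultimately show False by linarith
  qed
  then show ?thesis by blast
qed

section \<open>Coin tossing\<close>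

definition coin_space :: "(nat \<Rightarrow> bool) measure" where
  "coin_space = (\<Pi>\<^sub>M i\<in>UNIV. measure_pmf (bernoulli_pmf (1/2)))"

lemma space_coin_space: "space coin_space = UNIV"
  by (simp add: coin_space_def space_PiM)

interpretation coin: product_prob_space "\<lambda>_::nat. measure_pmf (bernoulli_pmf (1/2))" UNIV ..

interpretation coin_space: prob_space coin_space
  unfolding coin_space_def by (rule coin.P.prob_space_axioms)

lemma measurable_coordinate [measurable]: "(\<lambda>a. a i) \<in> measurable coin_space (count_space UNIV)"
proof -
  have "(\<lambda>a. a i) \<in> measurable coin_space (measure_pmf (bernoulli_pmf (1/2)))"
    unfolding coin_space_def by (rule measurable_component_singleton) simp
  then show ?thesis by simp
qed

lemma measurable_coin_space:
  assumes "\<And>i. (\<lambda>x. f x i) \<in> measurable N (count_space UNIV)"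
  shows "f \<in> measurable N coin_space"
  unfolding coin_space_def
  by (rule measurable_PiM_single') (use assms in \<open>auto simp: PiE_UNIV_domain\<close>)

lemma distr_coordinate:
  "distr coin_space (measure_pmf (bernoulli_pmf (1/2))) (\<lambda>a. a i) = measure_pmf (bernoulli_pmf (1/2))"
  unfolding coin_space_def by (rule coin.PiM_component) simp

lemma indep_coordinates:
  "coin_space.indep_vars (\<lambda>_. measure_pmf (bernoulli_pmf (1/2))) (\<lambda>i a. a i) UNIV"
proof (subst coin_space.indep_vars_iff_distr_eq_PiM)
  have "distr coin_space (\<Pi>\<^sub>M i\<in>UNIV. measure_pmf (bernoulli_pmf (1/2))) (\<lambda>x. \<lambda>i\<in>UNIV. x i) =
      distr coin_space coin_space (\<lambda>x. x)"
    by (simp add: coin_space_def restrict_def)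
  then show "distr coin_space (\<Pi>\<^sub>M i\<in>UNIV. measure_pmf (bernoulli_pmf (1/2))) (\<lambda>x. \<lambda>i\<in>UNIV. x i) =
      (\<Pi>\<^sub>M i\<in>UNIV. distr coin_space (measure_pmf (bernoulli_pmf (1/2))) (\<lambda>x. x i))"
    unfolding distr_coordinate by (simp add: coin_space_def)
qed auto

text \<open>Fairness enters here: negation preserves the law of each digit, and independence carries
  this over to the product. What holds for almost every \<open>a\<close> then also holds for almost
  every complement.\<close>

lemma distr_complement: "distr coin_space coin_space (\<lambda>a i. \<not> a i) = coin_space"
proof -
  let ?b = "measure_pmf (bernoulli_pmf (1/2))"
  have "coin_space.indep_vars (\<lambda>_. ?b) (\<lambda>i a. \<not> a i) UNIV"
    by (rule coin_space.indep_vars_compose2[OF indep_coordinates]) simp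
  then have "distr coin_space (\<Pi>\<^sub>M i\<in>UNIV. ?b) (\<lambda>x. \<lambda>i\<in>UNIV. \<not> x i) =
      (\<Pi>\<^sub>M i\<in>UNIV. distr coin_space ?b (\<lambda>x. \<not> x i))"
    by (subst (asm) coin_space.indep_vars_iff_distr_eq_PiM) auto
  moreover have "distr coin_space ?b (\<lambda>x. \<not> x i) = ?b" for i
  proof -
    have "distr coin_space ?b (\<lambda>x. \<not> x i) = distr (distr coin_space ?b (\<lambda>x. x i)) ?b Not"
      by (subst distr_distr) (auto simp: comp_def)
    also have "\<dots> = distr ?b (count_space UNIV) Not"
      unfolding distr_coordinate by (rule distr_cong) auto
    also have "\<dots> = measure_pmf (map_pmf Not (bernoulli_pmf (1/2)))"
      by (simp add: map_pmf_rep_eq)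
    also have "map_pmf Not (bernoulli_pmf (1/2)) = bernoulli_pmf (1/2)"
    proof (rule pmf_eqI)
      fix x :: bool
      have "pmf (map_pmf Not (bernoulli_pmf (1/2))) (Not (\<not> x)) = pmf (bernoulli_pmf (1/2)) (\<not> x)"
        by (rule pmf_map_inj') (auto intro: injI)
      then show "pmf (map_pmf Not (bernoulli_pmf (1/2))) x = pmf (bernoulli_pmf (1/2)) x"
        by (cases x) auto
    qed
    finally show ?thesis .
  qed
  ultimately show ?thesis by (simp add: coin_space_def restrict_def)
qed

text \<open>Invariance under flips makes \<open>X\<close> its own preimage under the map resetting
  the first \<open>n\<close> digits, which depends only on the digits from \<open>n\<close> on. So
  \<open>X\<close> is a tail event.\<close>

lemma coin_space_zero_one:
  assumes X: "X \<in> sets coin_space" and flip: "\<And>a n. a(n := True) \<in> X \<longleftrightarrow> a(n := False) \<in> X"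
  shows "measure coin_space X = 0 \<or> measure coin_space X = 1"
proof -
  define A where "A i = {(\<lambda>a. a i) -` B \<inter> space coin_space |B. B \<in> sets (measure_pmf (bernoulli_pmf (1/2)))}"
    for i :: nat
  have A: "sigma_algebra (space coin_space) (A i)" for i
  proof -
    have "A i = sets (vimage_algebra (space coin_space) (\<lambda>a. a i) (measure_pmf (bernoulli_pmf (1/2))))"
      unfolding A_def by (subst sets_vimage_algebra2) auto
    then show ?thesis
      using sets.sigma_algebra_axioms[of "vimage_algebra (space coin_space) (\<lambda>a. a i) (measure_pmf (bernoulli_pmf (1/2)))"]
      by simp
  qed
  have indep: "coin_space.indep_sets A UNIV"
    using indep_coordinates unfolding coin_space.indep_vars_def2 A_def by blast
  have upd: "a(n := v) \<in> X \<longleftrightarrow> a \<in> X" for a n v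
  proof -
    have "a(n := v) \<in> X \<longleftrightarrow> a(n := a n) \<in> X"
      using flip[of a n] by (cases v; cases "a n") simp_all
    then show ?thesis by simp
  qed
  have "X \<in> sigma_sets (space coin_space) (\<Union> (A ` {n..}))" for n
  proof -
    define N where "N = sigma (space coin_space) (\<Union> (A ` {n..}))"
    have sub: "\<Union> (A ` {n..}) \<subseteq> Pow (space coin_space)" by (auto simp: A_def)
    define r where "r m a = (\<lambda>i. if i < m then False else a i)" for m :: nat and a :: "nat \<Rightarrow> bool"
    have "r m a \<in> X \<longleftrightarrow> a \<in> X" for m a
    proof (induction m)
      case (Suc m)
      have "r (Suc m) a = (r m a)(m := False)" by (auto simp: r_def fun_eq_iff)
      then show ?case using Suc upd by metis
    qed (simp add: r_def)
    then have Xr: "X = r n -` X \<inter> space N"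
      by (auto simp: N_def space_measure_of[OF sub] space_coin_space)
    have "r n \<in> measurable N coin_space"
    proof (rule measurable_coin_space)
      fix i
      show "(\<lambda>a. r n a i) \<in> measurable N (count_space UNIV)"
      proof (cases "i < n")
        case False
        show ?thesis
        proof (rule measurableI)
          fix B :: "bool set"
          have "(\<lambda>a. a i) -` B \<inter> space coin_space \<in> A i" by (auto simp: A_def)
          then have "(\<lambda>a. a i) -` B \<inter> space coin_space \<in> \<Union> (A ` {n..})"
            using False by auto
          then show "(\<lambda>a. r n a i) -` B \<inter> space N \<in> sets N"
            using False unfolding N_def sets_measure_of[OF sub] space_measure_of[OF sub]
            by (auto simp: r_def)
        qed auto
      qed (simp add: r_def)
    qed
    then have "r n -` X \<inter> space N \<in> sets N" using X by (rule measurable_sets)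
    then show ?thesis using Xr by (simp add: N_def sets_measure_of[OF sub])
  qed
  then have "X \<in> coin_space.tail_events A" by (simp add: coin_space.tail_events_def)
  then show ?thesis by (rule coin_space.kolmogorov_0_1_law[OF A indep])
qed

text \<open>By the modulus of continuity, preimages of open sets are unions of cylinders, of which
  there are only countably many.\<close>

lemma measurable_bump_diffeo: "bump_diffeo \<in> measurable coin_space smooth_borel"
  unfolding smooth_borel_def
proof (rule measurable_measure_of)
  interpret Metric_space smooth_diffeos smooth_dist by (rule Metric_space_smooth)
  show "{U. openin smooth_topology U} \<subseteq> Pow smooth_diffeos"
    unfolding smooth_topology_def using openin_mtopology by auto
  show "bump_diffeo \<in> space coin_space \<rightarrow> smooth_diffeos" using bump_diffeo_smooth by auto
  fix U assume "U \<in> {U. openin smooth_topology U}"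
  then have U: "\<And>f. f \<in> U \<Longrightarrow> \<exists>r>0. mball f r \<subseteq> U"
    by (auto simp: smooth_topology_def openin_mtopology)
  \<comment> \<open>A cylinder prescribes the first \<open>N\<close> digits, coded by the finite set
    of places with digit \<open>True\<close>.\<close>
  define cyl where "cyl N s = {b. \<forall>n<N. b n = (n \<in> s)}" for N :: nat and s :: "nat set"
  define Cs where "Cs = (\<Union>N. cyl N ` Pow {..<N})"
  have "countable Cs" unfolding Cs_def
    by (rule countable_UN) (auto intro: countable_finite)
  have cyl_sets: "cyl N s \<in> sets coin_space" for N s
  proof -
    have "{b \<in> space coin_space. \<forall>n<N. b n = (n \<in> s)} \<in> sets coin_space" by measurable
    then show ?thesis by (simp add: cyl_def space_coin_space)
  qed
  have "bump_diffeo -` U = \<Union> {c \<in> Cs. c \<subseteq> bump_diffeo -` U}"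
  proof (intro equalityI subsetI)
    fix a assume "a \<in> bump_diffeo -` U"
    then obtain r where r: "r > 0" "mball (bump_diffeo a) r \<subseteq> U" using U by auto
    obtain N where N: "(1/2::real) ^ N < r / 2" using real_arch_pow_inv[of "r / 2" "1/2"] r(1) by auto
    define s where "s = {n. n < N \<and> a n}"
    have "cyl N s \<subseteq> bump_diffeo -` U"
    proof
      fix b assume "b \<in> cyl N s"
      then have "smooth_dist (bump_diffeo a) (bump_diffeo b) \<le> 2 * (1/2) ^ N"
        by (intro bump_diffeo_dist) (auto simp: cyl_def s_def)
      then have "bump_diffeo b \<in> mball (bump_diffeo a) r"
        using N bump_diffeo_smooth by (auto simp: in_mball)
      then show "b \<in> bump_diffeo -` U" using r(2) by auto
    qed
    moreover have "cyl N s \<in> Cs" by (auto simp: Cs_def s_def)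
    moreover have "a \<in> cyl N s" by (auto simp: cyl_def s_def)
    ultimately show "a \<in> \<Union> {c \<in> Cs. c \<subseteq> bump_diffeo -` U}" by blast
  qed auto
  moreover have "\<Union> {c \<in> Cs. c \<subseteq> bump_diffeo -` U} \<in> sets coin_space"
  proof (rule sets.countable_Union)
    show "countable {c \<in> Cs. c \<subseteq> bump_diffeo -` U}"
      using \<open>countable Cs\<close> by (rule countable_subset[rotated]) auto
  qed (use cyl_sets in \<open>auto simp: Cs_def\<close>)
  ultimately show "bump_diffeo -` U \<inter> space coin_space \<in> sets coin_space"
    by (simp add: space_coin_space)
qed

theorem theorem1:
  fixes D :: "(circle \<Rightarrow> circle) set"
  assumes "D \<in> regularity_classes"
  shows "\<not> (\<exists>\<phi> :: (circle \<Rightarrow> circle) \<Rightarrow> real.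
            \<phi> \<in> borel_measurable smooth_borel \<and>
            (\<forall>S\<in>smooth_diffeos. \<forall>T\<in>smooth_diffeos. conjugate_by D S T \<longleftrightarrow> \<phi> S = \<phi> T))"
proof
  assume "\<exists>\<phi> :: (circle \<Rightarrow> circle) \<Rightarrow> real.
            \<phi> \<in> borel_measurable smooth_borel \<and>
            (\<forall>S\<in>smooth_diffeos. \<forall>T\<in>smooth_diffeos. conjugate_by D S T \<longleftrightarrow> \<phi> S = \<phi> T)"
  then obtain \<phi> :: "(circle \<Rightarrow> circle) \<Rightarrow> real"
    where \<phi>: "\<phi> \<in> borel_measurable smooth_borel"
    and inv: "\<forall>S\<in>smooth_diffeos. \<forall>T\<in>smooth_diffeos. conjugate_by D S T \<longleftrightarrow> \<phi> S = \<phi> T"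
    by (elim exE conjE)
  define f where "f a = \<phi> (bump_diffeo a)" for a
  have f [measurable]: "f \<in> borel_measurable coin_space"
    unfolding f_def using measurable_compose[OF measurable_bump_diffeo \<phi>] .
  have conj: "conjugate_by D (bump_diffeo a) (bump_diffeo b) \<longleftrightarrow> f a = f b" for a b
    unfolding f_def using inv bump_diffeo_smooth by blast
  have flip: "f (a(n := True)) = f (a(n := False))" for a n
    using bump_diffeo_flip[of a n] smooth_diffeos_subset_regularity_class[OF assms]
    unfolding conj[symmetric] conjugate_by_def by blast
  \<comment> \<open>\<open>P q\<close> says that the distribution function of \<open>f\<close> is 1
    at \<open>q\<close>; by the 0-1 law its only other value is 0. Rational thresholds reduce almost
    sure constancy to countably many events.\<close>
  define P where "P q \<longleftrightarrow> measure coin_space {a \<in> space coin_space. f a \<le> q} = 1" for q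
  have ae: "AE a in coin_space. f a \<le> q \<longleftrightarrow> P q" for q
  proof -
    have m: "{a \<in> space coin_space. f a \<le> q} \<in> sets coin_space" by measurable
    have "measure coin_space {a \<in> space coin_space. f a \<le> q} = 0 \<or>
        measure coin_space {a \<in> space coin_space. f a \<le> q} = 1"
      by (rule coin_space_zero_one[OF m]) (use flip in \<open>auto simp: space_coin_space\<close>)
    then show ?thesis
    proof
      assume z: "measure coin_space {a \<in> space coin_space. f a \<le> q} = 0"
      then have "AE a in coin_space. \<not> f a \<le> q"
        using m by (subst (asm) coin_space.prob_eq_0) auto
      then show ?thesis using z by (simp add: P_def)
    next
      assume z: "measure coin_space {a \<in> space coin_space. f a \<le> q} = 1"
      then have "AE a in coin_space. f a \<le> q"
        using m by (subst (asm) coin_space.prob_eq_1) auto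
      then show ?thesis using z by (simp add: P_def)
    qed
  qed
  have compl: "(\<lambda>a i. \<not> a i) \<in> measurable coin_space coin_space"
    by (rule measurable_coin_space) measurable
  have "AE a in coin_space. \<forall>q\<in>\<rat>. (f a \<le> q \<longleftrightarrow> P q)"
    using ae by (subst AE_ball_countable) (auto simp: countable_rat)
  \<comment> \<open>Complementing preserves the measure, so almost every \<open>a\<close> has the
    same rational cut for \<open>f\<close> as its complement.\<close>
  then have both: "AE a in coin_space. (\<forall>q\<in>\<rat>. (f a \<le> q \<longleftrightarrow> P q)) \<and> (\<forall>q\<in>\<rat>. (f (\<lambda>i. \<not> a i) \<le> q \<longleftrightarrow> P q))"
  proof (rule AE_conjI)
    have "AE a in distr coin_space coin_space (\<lambda>a i. \<not> a i). f a \<le> q \<longleftrightarrow> P q" for q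
      unfolding distr_complement by (rule ae)
    then have "AE a in coin_space. f (\<lambda>i. \<not> a i) \<le> q \<longleftrightarrow> P q" for q
      by (subst (asm) AE_distr_iff[OF compl]) measurable
    then show "AE a in coin_space. \<forall>q\<in>\<rat>. (f (\<lambda>i. \<not> a i) \<le> q \<longleftrightarrow> P q)"
      by (subst AE_ball_countable) (auto simp: countable_rat)
  qed
  obtain a where a: "\<forall>q\<in>\<rat>. (f a \<le> q \<longleftrightarrow> P q)" "\<forall>q\<in>\<rat>. (f (\<lambda>i. \<not> a i) \<le> q \<longleftrightarrow> P q)"
    using eventually_happens[OF both] coin_space.ae_filter_bot by blast
  have le: "u \<le> v" if "\<forall>q\<in>\<rat>. v \<le> q \<longrightarrow> u \<le> q" for u v :: real
  proof (rule ccontr)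
    assume "\<not> u \<le> v"
    then obtain q where "q \<in> \<rat>" "v < q" "q < u" using Rats_dense_in_real[of v u] by auto
    then show False using that by force
  qed
  have eq: "f a = f (\<lambda>i. \<not> a i)"
  proof (rule antisym)
    show "f a \<le> f (\<lambda>i. \<not> a i)" by (rule le) (use a in simp)
    show "f (\<lambda>i. \<not> a i) \<le> f a" by (rule le) (use a in simp)
  qed
  have bounded: "\<exists>M. \<forall>N\<ge>M. \<not> (\<not> b N \<and> c N)" if "f b = f c" for b c
  proof -
    have "conjugate_by D (bump_diffeo b) (bump_diffeo c)" using conj that by simp
    then obtain h where h: "h \<in> D" "bump_diffeo b = h \<circ> bump_diffeo c \<circ> inv h"
      unfolding conjugate_by_def by (elim bexE)
    obtain \<beta> where "0 < \<beta>" "hoelder_on_circle \<beta> h" "h \<in> circle_homeos"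
      by (rule regularity_class_hoelder[OF assms h(1)])
    then show ?thesis using hoelder_conjugacy_bounded[OF _ h(2)] by blast
  qed
  \<comment> \<open>The complement differs from \<open>a\<close> everywhere, so one conjugacy makes
    \<open>a\<close> eventually true, and the one in the opposite direction makes it eventually
    false.\<close>
  obtain M1 where "\<forall>N\<ge>M1. a N" using bounded[OF eq] by auto
  moreover obtain M2 where "\<forall>N\<ge>M2. \<not> a N" using bounded[OF eq[symmetric]] by auto
  ultimately show False by (meson nat_le_linear)
qed

end
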